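(* Let $\Gamma$ be a groupoid, $R$ a $\Gamma$-graded ring and $P$ a nonzero gr-projective $\Gamma$-graded right $R$-module. Then $\mathrm{rad}^{\mathrm{gr}}(P)\neq P$, that is, $P$ contains a gr-maximal graded submodule.
   Context: A groupoid $\Gamma$ is the set of morphisms of a small category in which all morphisms are invertible; $\Gamma_0\subseteq\Gamma$ is the set of identity morphisms; $d(\gamma)=\gamma^{-1}\gamma$, $r(\gamma)=\gamma\gamma^{-1}$; the product $\gamma\delta$ is defined iff $d(\gamma)=r(\delta)$. Rings are associative, not necessarily unital. A $\Gamma$-graded ring is a ring $R=\bigoplus_{\gamma\in\Gamma}R_\gamma$ (additive subgroups) with $R_\gamma R_\delta\subseteq R_{\gamma\delta}$ if $d(\gamma)=r(\delta)$ and $R_\gamma R_\delta=0$ otherwise; it is always assumed object unital: for each $e\in\Gamma_0$ the ring $R_e$ has an identity $1_e$ (possibly $0$) with $1_{r(\gamma)}a=a=a1_{d(\gamma)}$ for all $a\in R_\gamma$, $\gamma\in\Gamma$. A $\Gamma$-graded right $R$-module is a right $R$-module $M=\bigoplus_{\gamma}M_\gamma$ with $M_\sigma R_\tau\subseteq M_{\sigma\tau}$ if $d(\sigma)=r(\tau)$, $M_\sigma R_\tau=0$ otherwise, and $m1_{d(\sigma)}=m$ for $m\in M_\sigma$. A submodule $N$ is graded if $N=\bigoplus_\gamma (N\cap M_\gamma)$. A gr-homomorphism $g:M\to N$ of graded right modules is an $R$-homomorphism with $g(M_\sigma)\subseteq N_\sigma$ for all $\sigma\in\Gamma$. A $\Gamma$-graded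 right $R$-module $P$ is gr-projective if for all $\Gamma$-graded right $R$-modules $M,N$, every surjective gr-homomorphism $g:M\to N$ and every gr-homomorphism $h:P\to N$, there is a gr-homomorphism $h':P\to M$ with $g\circ h'=h$. A gr-maximal graded submodule of $M$ is a maximal element among the proper graded submodules of $M$. $\mathrm{rad}^{\mathrm{gr}}(M)$ is the intersection of all gr-maximal graded submodules of $M$, and $\mathrm{rad}^{\mathrm{gr}}(M)=M$ if there are none. *)

theory Defs
  imports "HOL-Algebra.AbelCoset"
begin

section \<open>Groupoids\<close>

text \<open>
  Categories are presented by their arrows only: objects are identified with identity arrows, so
  \<open>src\<close> and \<open>tgt\<close> take values in the arrows. Composition is meaningful only for arrows with
  \<open>src \<gamma> = tgt \<delta>\<close>; on other arguments \<open>cmp\<close> is unconstrained.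
\<close>

record 'g arrows = "'g partial_object" +
  src :: "'g \<Rightarrow> 'g"
  tgt :: "'g \<Rightarrow> 'g"
  cmp :: "'g \<Rightarrow> 'g \<Rightarrow> 'g"

locale small_category =
  fixes \<Gamma> :: "'g arrows"
  assumes src_closed: "\<gamma> \<in> carrier \<Gamma> \<Longrightarrow> src \<Gamma> \<gamma> \<in> carrier \<Gamma>"
    and tgt_closed: "\<gamma> \<in> carrier \<Gamma> \<Longrightarrow> tgt \<Gamma> \<gamma> \<in> carrier \<Gamma>"
    and src_src: "\<gamma> \<in> carrier \<Gamma> \<Longrightarrow> src \<Gamma> (src \<Gamma> \<gamma>) = src \<Gamma> \<gamma>"
    and tgt_src: "\<gamma> \<in> carrier \<Gamma> \<Longrightarrow> tgt \<Gamma> (src \<Gamma> \<gamma>) = src \<Gamma> \<gamma>"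
    and src_tgt: "\<gamma> \<in> carrier \<Gamma> \<Longrightarrow> src \<Gamma> (tgt \<Gamma> \<gamma>) = tgt \<Gamma> \<gamma>"
    and tgt_tgt: "\<gamma> \<in> carrier \<Gamma> \<Longrightarrow> tgt \<Gamma> (tgt \<Gamma> \<gamma>) = tgt \<Gamma> \<gamma>"
    and cmp_closed: "\<lbrakk>\<gamma> \<in> carrier \<Gamma>; \<delta> \<in> carrier \<Gamma>; src \<Gamma> \<gamma> = tgt \<Gamma> \<delta>\<rbrakk> \<Longrightarrow> cmp \<Gamma> \<gamma> \<delta> \<in> carrier \<Gamma>"
    and src_cmp: "\<lbrakk>\<gamma> \<in> carrier \<Gamma>; \<delta> \<in> carrier \<Gamma>; src \<Gamma> \<gamma> = tgt \<Gamma> \<delta>\<rbrakk> \<Longrightarrow> src \<Gamma> (cmp \<Gamma> \<gamma> \<delta>) = src \<Gamma> \<delta>"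
    and tgt_cmp: "\<lbrakk>\<gamma> \<in> carrier \<Gamma>; \<delta> \<in> carrier \<Gamma>; src \<Gamma> \<gamma> = tgt \<Gamma> \<delta>\<rbrakk> \<Longrightarrow> tgt \<Gamma> (cmp \<Gamma> \<gamma> \<delta>) = tgt \<Gamma> \<gamma>"
    and cmp_assoc: "\<lbrakk>\<gamma> \<in> carrier \<Gamma>; \<delta> \<in> carrier \<Gamma>; \<epsilon> \<in> carrier \<Gamma>;
        src \<Gamma> \<gamma> = tgt \<Gamma> \<delta>; src \<Gamma> \<delta> = tgt \<Gamma> \<epsilon>\<rbrakk>
        \<Longrightarrow> cmp \<Gamma> (cmp \<Gamma> \<gamma> \<delta>) \<epsilon> = cmp \<Gamma> \<gamma> (cmp \<Gamma> \<delta> \<epsilon>)"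
    and cmp_src_id: "\<gamma> \<in> carrier \<Gamma> \<Longrightarrow> cmp \<Gamma> \<gamma> (src \<Gamma> \<gamma>) = \<gamma>"
    and tgt_cmp_id: "\<gamma> \<in> carrier \<Gamma> \<Longrightarrow> cmp \<Gamma> (tgt \<Gamma> \<gamma>) \<gamma> = \<gamma>"

definition identities :: "'g arrows \<Rightarrow> 'g set" where
  "identities \<Gamma> = src \<Gamma> ` carrier \<Gamma>"

locale groupoid = small_category +
  assumes invertible: "\<gamma> \<in> carrier \<Gamma> \<Longrightarrow> \<exists>\<delta>\<in>carrier \<Gamma>. src \<Gamma> \<delta> = tgt \<Gamma> \<gamma> \<and> tgt \<Gamma> \<delta> = src \<Gamma> \<gamma> \<and>
    cmp \<Gamma> \<delta> \<gamma> = src \<Gamma> \<gamma> \<and> cmp \<Gamma> \<gamma> \<delta> = tgt \<Gamma> \<gamma>"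


section \<open>Internal direct sums\<close>

definition direct_sum_families ::
  "('a, 'k) ring_scheme \<Rightarrow> 'i set \<Rightarrow> ('i \<Rightarrow> 'a set) \<Rightarrow> ('i \<Rightarrow> 'a) set" where
  "direct_sum_families G I A =
    {f. (\<forall>i\<in>I. f i \<in> A i) \<and> (\<forall>i. i \<notin> I \<longrightarrow> f i = \<zero>\<^bsub>G\<^esub>) \<and> finite {i. f i \<noteq> \<zero>\<^bsub>G\<^esub>}}"

text \<open>\<open>S = \<Oplus>\<^sub>i A i\<close> inside the additive group of \<open>G\<close>, for a subset \<open>S\<close> of the carrier.\<close>

definition internal_direct_sum ::
  "('a, 'k) ring_scheme \<Rightarrow> 'i set \<Rightarrow> ('i \<Rightarrow> 'a set) \<Rightarrow> 'a set \<Rightarrow> bool" where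
  "internal_direct_sum G I A S \<longleftrightarrow>
    (\<forall>i\<in>I. additive_subgroup (A i) G) \<and>
    bij_betw (\<lambda>f. finsum G f {i. f i \<noteq> \<zero>\<^bsub>G\<^esub>}) (direct_sum_families G I A) S"


section \<open>Graded rings\<close>

text \<open>
  Rings need not be unital, so the field \<open>one\<close> of the library's ring record is
  unconstrained junk; the same holds for \<open>mult\<close> and \<open>one\<close> of a module below.
\<close>

record ('a, 'g) graded = "'a ring" +
  homog :: "'g \<Rightarrow> 'a set"

locale nonunital_ring = abelian_group R for R (structure) +
  assumes m_closed: "\<lbrakk>x \<in> carrier R; y \<in> carrier R\<rbrakk> \<Longrightarrow> x \<otimes> y \<in> carrier R"
    and m_assoc: "\<lbrakk>x \<in> carrier R; y \<in> carrier R; z \<in> carrier R\<rbrakk> \<Longrightarrow> (x \<otimes> y) \<otimes> z = x \<otimes> (y \<otimes> z)"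
    and l_distr: "\<lbrakk>x \<in> carrier R; y \<in> carrier R; z \<in> carrier R\<rbrakk> \<Longrightarrow> (x \<oplus> y) \<otimes> z = x \<otimes> z \<oplus> y \<otimes> z"
    and r_distr: "\<lbrakk>x \<in> carrier R; y \<in> carrier R; z \<in> carrier R\<rbrakk> \<Longrightarrow> z \<otimes> (x \<oplus> y) = z \<otimes> x \<oplus> z \<otimes> y"

definition is_identity_of :: "('a, 'k) ring_scheme \<Rightarrow> 'a set \<Rightarrow> 'a \<Rightarrow> bool" where
  "is_identity_of R S u \<longleftrightarrow> u \<in> S \<and> (\<forall>a\<in>S. u \<otimes>\<^bsub>R\<^esub> a = a \<and> a \<otimes>\<^bsub>R\<^esub> u = a)"

text \<open>The element \<open>1\<^sub>e\<close>; identities are unique, so this is well defined as soon as one exists.\<close>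

definition obj_one :: "('r, 'g) graded \<Rightarrow> 'g \<Rightarrow> 'r" where
  "obj_one R e = (THE u. is_identity_of R (homog R e) u)"

locale graded_ring = groupoid \<Gamma> + nonunital_ring R
  for \<Gamma> :: "'g arrows" and R :: "('r, 'g) graded" +
  assumes ring_grading: "internal_direct_sum R (carrier \<Gamma>) (homog R) (carrier R)"
    and ring_homog_mult: "\<lbrakk>\<gamma> \<in> carrier \<Gamma>; \<delta> \<in> carrier \<Gamma>; src \<Gamma> \<gamma> = tgt \<Gamma> \<delta>; a \<in> homog R \<gamma>; b \<in> homog R \<delta>\<rbrakk>
        \<Longrightarrow> a \<otimes>\<^bsub>R\<^esub> b \<in> homog R (cmp \<Gamma> \<gamma> \<delta>)"
    and ring_homog_mult_zero: "\<lbrakk>\<gamma> \<in> carrier \<Gamma>; \<delta> \<in> carrier \<Gamma>; src \<Gamma> \<gamma> \<noteq> tgt \<Gamma> \<delta>; a \<in> homog R \<gamma>; b \<in> homog R \<delta>\<rbrakk>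
        \<Longrightarrow> a \<otimes>\<^bsub>R\<^esub> b = \<zero>\<^bsub>R\<^esub>"
    and ex_identity: "e \<in> identities \<Gamma> \<Longrightarrow> \<exists>u. is_identity_of R (homog R e) u"
    and obj_one_left: "\<lbrakk>\<gamma> \<in> carrier \<Gamma>; a \<in> homog R \<gamma>\<rbrakk> \<Longrightarrow> obj_one R (tgt \<Gamma> \<gamma>) \<otimes>\<^bsub>R\<^esub> a = a"
    and obj_one_right: "\<lbrakk>\<gamma> \<in> carrier \<Gamma>; a \<in> homog R \<gamma>\<rbrakk> \<Longrightarrow> a \<otimes>\<^bsub>R\<^esub> obj_one R (src \<Gamma> \<gamma>) = a"


section \<open>Graded right modules\<close>

record ('m, 'g, 'r) graded_rmod = "('m, 'g) graded" +
  ract :: "'m \<Rightarrow> 'r \<Rightarrow> 'm"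

locale graded_right_module = graded_ring \<Gamma> R + M: abelian_group M
  for \<Gamma> :: "'g arrows" and R :: "('r, 'g) graded" and M :: "('m, 'g, 'r) graded_rmod" +
  assumes ract_closed: "\<lbrakk>x \<in> carrier M; r \<in> carrier R\<rbrakk> \<Longrightarrow> ract M x r \<in> carrier M"
    and ract_add_left: "\<lbrakk>x \<in> carrier M; y \<in> carrier M; r \<in> carrier R\<rbrakk>
        \<Longrightarrow> ract M (x \<oplus>\<^bsub>M\<^esub> y) r = ract M x r \<oplus>\<^bsub>M\<^esub> ract M y r"
    and ract_add_right: "\<lbrakk>x \<in> carrier M; r \<in> carrier R; s \<in> carrier R\<rbrakk>
        \<Longrightarrow> ract M x (r \<oplus>\<^bsub>R\<^esub> s) = ract M x r \<oplus>\<^bsub>M\<^esub> ract M x s"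
    and ract_assoc: "\<lbrakk>x \<in> carrier M; r \<in> carrier R; s \<in> carrier R\<rbrakk>
        \<Longrightarrow> ract M x (r \<otimes>\<^bsub>R\<^esub> s) = ract M (ract M x r) s"
    and mod_grading: "internal_direct_sum M (carrier \<Gamma>) (homog M) (carrier M)"
    and homog_ract: "\<lbrakk>\<sigma> \<in> carrier \<Gamma>; \<tau> \<in> carrier \<Gamma>; src \<Gamma> \<sigma> = tgt \<Gamma> \<tau>; x \<in> homog M \<sigma>; r \<in> homog R \<tau>\<rbrakk>
        \<Longrightarrow> ract M x r \<in> homog M (cmp \<Gamma> \<sigma> \<tau>)"
    and homog_ract_zero: "\<lbrakk>\<sigma> \<in> carrier \<Gamma>; \<tau> \<in> carrier \<Gamma>; src \<Gamma> \<sigma> \<noteq> tgt \<Gamma> \<tau>; x \<in> homog M \<sigma>; r \<in> homog R \<tau>\<rbrakk>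
        \<Longrightarrow> ract M x r = \<zero>\<^bsub>M\<^esub>"
    and ract_obj_one: "\<lbrakk>\<sigma> \<in> carrier \<Gamma>; x \<in> homog M \<sigma>\<rbrakk> \<Longrightarrow> ract M x (obj_one R (src \<Gamma> \<sigma>)) = x"

definition gr_submodule ::
  "'g arrows \<Rightarrow> ('r, 'g) graded \<Rightarrow> ('m, 'g, 'r) graded_rmod \<Rightarrow> 'm set \<Rightarrow> bool" where
  "gr_submodule \<Gamma> R M N \<longleftrightarrow>
    additive_subgroup N M \<and> (\<forall>x\<in>N. \<forall>r\<in>carrier R. ract M x r \<in> N) \<and>
    internal_direct_sum M (carrier \<Gamma>) (\<lambda>\<gamma>. N \<inter> homog M \<gamma>) N"

definition gr_hom ::
  "'g arrows \<Rightarrow> ('r, 'g) graded \<Rightarrow> ('m, 'g, 'r) graded_rmod \<Rightarrow> ('n, 'g, 'r) graded_rmod \<Rightarrow> ('m \<Rightarrow> 'n) set" where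
  "gr_hom \<Gamma> R M N =
    {g. g \<in> carrier M \<rightarrow> carrier N \<and>
        (\<forall>x\<in>carrier M. \<forall>y\<in>carrier M. g (x \<oplus>\<^bsub>M\<^esub> y) = g x \<oplus>\<^bsub>N\<^esub> g y) \<and>
        (\<forall>x\<in>carrier M. \<forall>r\<in>carrier R. g (ract M x r) = ract N (g x) r) \<and>
        (\<forall>\<sigma>\<in>carrier \<Gamma>. g ` homog M \<sigma> \<subseteq> homog N \<sigma>)}"

definition gr_maximal ::
  "'g arrows \<Rightarrow> ('r, 'g) graded \<Rightarrow> ('m, 'g, 'r) graded_rmod \<Rightarrow> 'm set \<Rightarrow> bool" where
  "gr_maximal \<Gamma> R M N \<longleftrightarrow>
    gr_submodule \<Gamma> R M N \<and> N \<noteq> carrier M \<and>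
    (\<forall>N'. gr_submodule \<Gamma> R M N' \<and> N' \<noteq> carrier M \<and> N \<subseteq> N' \<longrightarrow> N' = N)"

definition gr_rad ::
  "'g arrows \<Rightarrow> ('r, 'g) graded \<Rightarrow> ('m, 'g, 'r) graded_rmod \<Rightarrow> 'm set" where
  "gr_rad \<Gamma> R M =
    (if \<exists>N. gr_maximal \<Gamma> R M N then \<Inter> {N. gr_maximal \<Gamma> R M N} else carrier M)"


section \<open>Graded projectivity\<close>

definition gr_lifting ::
  "'g arrows \<Rightarrow> ('r, 'g) graded \<Rightarrow> ('p, 'g, 'r) graded_rmod \<Rightarrow>
   ('m, 'g, 'r) graded_rmod \<Rightarrow> ('n, 'g, 'r) graded_rmod \<Rightarrow> bool" where
  "gr_lifting \<Gamma> R P M N \<longleftrightarrow>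
    (\<forall>g\<in>gr_hom \<Gamma> R M N. \<forall>h\<in>gr_hom \<Gamma> R P N. g ` carrier M = carrier N \<longrightarrow>
      (\<exists>h'\<in>gr_hom \<Gamma> R P M. \<forall>x\<in>carrier P. g (h' x) = h x))"

text \<open>
  A HOL definition cannot quantify over modules on all types at once. The test modules below
  therefore live on one type, \<open>('p \<times> 'r) list\<close>, whose elements serve as formal sums of products
  \<open>p \<cdot> r\<close>. Nothing is lost: by \<open>gr_projective_lifting\<close> at the end of this theory, lifting against
  these test modules implies lifting against graded modules \<open>M\<close>, \<open>N\<close> on arbitrary types.
\<close>

definition gr_projective ::
  "'g arrows \<Rightarrow> ('r, 'g) graded \<Rightarrow> ('p, 'g, 'r) graded_rmod \<Rightarrow> bool" where
  "gr_projective \<Gamma> R P \<longleftrightarrow>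
    (\<forall>(M :: (('p \<times> 'r) list, 'g, 'r) graded_rmod) (N :: (('p \<times> 'r) list, 'g, 'r) graded_rmod).
      graded_right_module \<Gamma> R M \<longrightarrow> graded_right_module \<Gamma> R N \<longrightarrow> gr_lifting \<Gamma> R P M N)"

section \<open>Graded projectivity does not depend on the type of the test modules\<close>

lemma additive_hom_finsum:
  assumes G: "abelian_group G" and H: "abelian_group H"
    and u: "u \<in> carrier G \<rightarrow> carrier H"
    and add: "\<And>x y. x \<in> carrier G \<Longrightarrow> y \<in> carrier G \<Longrightarrow> u (x \<oplus>\<^bsub>G\<^esub> y) = u x \<oplus>\<^bsub>H\<^esub> u y"
  shows additive_hom_zero: "u \<zero>\<^bsub>G\<^esub> = \<zero>\<^bsub>H\<^esub>"
    and "f \<in> A \<rightarrow> carrier G \<Longrightarrow> u (finsum G f A) = finsum H (\<lambda>i. u (f i)) A"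
proof -
  interpret G: abelian_group G by fact
  interpret H: abelian_group H by fact
  have z: "u \<zero>\<^bsub>G\<^esub> \<in> carrier H" using u by auto
  have "u \<zero>\<^bsub>G\<^esub> \<oplus>\<^bsub>H\<^esub> u \<zero>\<^bsub>G\<^esub> = u \<zero>\<^bsub>G\<^esub>"
    using add[of "\<zero>\<^bsub>G\<^esub>" "\<zero>\<^bsub>G\<^esub>"] by simp
  then show zero: "u \<zero>\<^bsub>G\<^esub> = \<zero>\<^bsub>H\<^esub>"
    using z by (metis H.add.r_cancel_one')
  show "u (finsum G f A) = finsum H (\<lambda>i. u (f i)) A" if "f \<in> A \<rightarrow> carrier G"
    using that
  proof (induction A rule: infinite_finite_induct)
    case (insert a A)
    have 1: "f \<in> A \<rightarrow> carrier G" "f a \<in> carrier G" using insert.prems by auto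
    then have 2: "(\<lambda>i. u (f i)) \<in> A \<rightarrow> carrier H" "u (f a) \<in> carrier H" using u by auto
    show ?case
      using insert.hyps insert.IH[OF 1(1)] 1 2 add[OF 1(2) G.finsum_closed[OF 1(1)]]
      by (simp add: G.finsum_insert H.finsum_insert)
  qed (auto simp: zero)
qed

lemma finsum_support:
  assumes "abelian_group G" "finite F" "{i. f i \<noteq> \<zero>\<^bsub>G\<^esub>} \<subseteq> F" "f \<in> F \<rightarrow> carrier G"
  shows "finsum G f {i. f i \<noteq> \<zero>\<^bsub>G\<^esub>} = finsum G f F"
proof -
  interpret G: abelian_group G by fact
  show ?thesis
    by (rule G.add.finprod_mono_neutral_cong_left) (use assms in auto)
qed

lemma additive_subgroup_finsum:
  assumes "abelian_group G" "additive_subgroup S G" "f \<in> A \<rightarrow> S"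
  shows "finsum G f A \<in> S"
proof -
  interpret G: abelian_group G by fact
  interpret S: additive_subgroup S G by fact
  show ?thesis using assms(3)
  proof (induction A rule: infinite_finite_induct)
    case (insert a A)
    then have "f \<in> A \<rightarrow> S" "f a \<in> S" by auto
    moreover from this have "f \<in> A \<rightarrow> carrier G" "f a \<in> carrier G" using S.a_subset by auto
    ultimately show ?case using insert by (simp add: G.finsum_insert)
  qed auto
qed

lemma additive_subgroupI':
  assumes "abelian_group G" "S \<subseteq> carrier G" "\<zero>\<^bsub>G\<^esub> \<in> S"
    "\<And>x y. x \<in> S \<Longrightarrow> y \<in> S \<Longrightarrow> x \<oplus>\<^bsub>G\<^esub> y \<in> S" "\<And>x. x \<in> S \<Longrightarrow> \<ominus>\<^bsub>G\<^esub> x \<in> S"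
  shows "additive_subgroup S G"
proof -
  interpret G: abelian_group G by fact
  show ?thesis
    by (intro additive_subgroupI G.add.subgroupI) (use assms in auto)
qed

context graded_right_module
begin

lemma homog_subgroup: "\<sigma> \<in> carrier \<Gamma> \<Longrightarrow> additive_subgroup (homog M \<sigma>) M"
  using mod_grading by (simp add: internal_direct_sum_def)

lemma homog_carrier: "\<sigma> \<in> carrier \<Gamma> \<Longrightarrow> x \<in> homog M \<sigma> \<Longrightarrow> x \<in> carrier M"
  using additive_subgroup.a_subset[OF homog_subgroup] by auto

lemma ring_homog_carrier: "\<sigma> \<in> carrier \<Gamma> \<Longrightarrow> x \<in> homog R \<sigma> \<Longrightarrow> x \<in> carrier R"
  using ring_grading additive_subgroup.a_subset by (fastforce simp: internal_direct_sum_def)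

lemma obj_one_carrier:
  assumes "e \<in> identities \<Gamma>"
  shows "obj_one R e \<in> carrier R"
proof -
  obtain u where u: "is_identity_of R (homog R e) u" using ex_identity[OF assms] by blast
  have "is_identity_of R (homog R e) (obj_one R e)"
    unfolding obj_one_def
  proof (rule theI[where P = "is_identity_of R (homog R e)", OF u])
    fix v assume v: "is_identity_of R (homog R e) v"
    have "u \<otimes>\<^bsub>R\<^esub> v = v" using u v unfolding is_identity_of_def by blast
    moreover have "u \<otimes>\<^bsub>R\<^esub> v = u" using u v unfolding is_identity_of_def by blast
    ultimately show "v = u" by metis
  qed
  moreover have "e \<in> carrier \<Gamma>" using assms src_closed by (auto simp: identities_def)
  ultimately show ?thesis using ring_homog_carrier by (auto simp: is_identity_of_def)
qed

lemma ract_zero_left: "r \<in> carrier R \<Longrightarrow> ract M \<zero>\<^bsub>M\<^esub> r = \<zero>\<^bsub>M\<^esub>"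
  by (rule additive_hom_zero[of M M "\<lambda>x. ract M x r"])
    (auto intro: ract_closed ract_add_left M.abelian_group_axioms)

lemma ract_zero_right: "x \<in> carrier M \<Longrightarrow> ract M x \<zero>\<^bsub>R\<^esub> = \<zero>\<^bsub>M\<^esub>"
  by (rule additive_hom_zero[of R M "ract M x"])
    (auto intro: ract_closed ract_add_right M.abelian_group_axioms abelian_group_axioms)

lemma ract_uminus:
  assumes "x \<in> carrier M" "r \<in> carrier R"
  shows "ract M x (\<ominus>\<^bsub>R\<^esub> r) = \<ominus>\<^bsub>M\<^esub> ract M x r"
proof -
  have "ract M x (\<ominus>\<^bsub>R\<^esub> r) \<oplus>\<^bsub>M\<^esub> ract M x r = \<zero>\<^bsub>M\<^esub>"
    using assms ract_add_right[of x "\<ominus>\<^bsub>R\<^esub> r" r] by (simp add: l_neg ract_zero_right)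
  then show ?thesis using assms by (simp add: M.minus_equality ract_closed)
qed

lemma decompose:
  assumes "x \<in> carrier M"
  obtains f where "\<And>\<sigma>. \<sigma> \<in> carrier \<Gamma> \<Longrightarrow> f \<sigma> \<in> homog M \<sigma>" "finite {\<sigma>. f \<sigma> \<noteq> \<zero>\<^bsub>M\<^esub>}"
    "{\<sigma>. f \<sigma> \<noteq> \<zero>\<^bsub>M\<^esub>} \<subseteq> carrier \<Gamma>" "x = finsum M f {\<sigma>. f \<sigma> \<noteq> \<zero>\<^bsub>M\<^esub>}"
proof -
  have "x \<in> (\<lambda>f. finsum M f {i. f i \<noteq> \<zero>\<^bsub>M\<^esub>}) ` direct_sum_families M (carrier \<Gamma>) (homog M)"
    using mod_grading assms by (simp add: internal_direct_sum_def bij_betw_def)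
  then obtain f where f: "f \<in> direct_sum_families M (carrier \<Gamma>) (homog M)"
    "x = finsum M f {\<sigma>. f \<sigma> \<noteq> \<zero>\<^bsub>M\<^esub>}" by blast
  from f(1) have "\<forall>\<sigma>\<in>carrier \<Gamma>. f \<sigma> \<in> homog M \<sigma>" "{\<sigma>. f \<sigma> \<noteq> \<zero>\<^bsub>M\<^esub>} \<subseteq> carrier \<Gamma>"
    "finite {\<sigma>. f \<sigma> \<noteq> \<zero>\<^bsub>M\<^esub>}"
    by (auto simp: direct_sum_families_def)
  with f(2) show thesis by (intro that[of f]) auto
qed

lemma ring_decompose:
  assumes "r \<in> carrier R"
  obtains f where "\<And>\<sigma>. \<sigma> \<in> carrier \<Gamma> \<Longrightarrow> f \<sigma> \<in> homog R \<sigma>" "finite {\<sigma>. f \<sigma> \<noteq> \<zero>\<^bsub>R\<^esub>}"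
    "{\<sigma>. f \<sigma> \<noteq> \<zero>\<^bsub>R\<^esub>} \<subseteq> carrier \<Gamma>" "r = finsum R f {\<sigma>. f \<sigma> \<noteq> \<zero>\<^bsub>R\<^esub>}"
proof -
  have "r \<in> (\<lambda>f. finsum R f {i. f i \<noteq> \<zero>\<^bsub>R\<^esub>}) ` direct_sum_families R (carrier \<Gamma>) (homog R)"
    using ring_grading assms by (simp add: internal_direct_sum_def bij_betw_def)
  then obtain f where f: "f \<in> direct_sum_families R (carrier \<Gamma>) (homog R)"
    "r = finsum R f {\<sigma>. f \<sigma> \<noteq> \<zero>\<^bsub>R\<^esub>}" by blast
  from f(1) have "\<forall>\<sigma>\<in>carrier \<Gamma>. f \<sigma> \<in> homog R \<sigma>" "{\<sigma>. f \<sigma> \<noteq> \<zero>\<^bsub>R\<^esub>} \<subseteq> carrier \<Gamma>"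
    "finite {\<sigma>. f \<sigma> \<noteq> \<zero>\<^bsub>R\<^esub>}"
    by (auto simp: direct_sum_families_def)
  with f(2) show thesis by (intro that[of f]) auto
qed

lemma decomposition_unique:
  assumes f: "f \<in> direct_sum_families M (carrier \<Gamma>) (homog M)"
    and g: "g \<in> direct_sum_families M (carrier \<Gamma>) (homog M)"
    and "finsum M f {\<sigma>. f \<sigma> \<noteq> \<zero>\<^bsub>M\<^esub>} = finsum M g {\<sigma>. g \<sigma> \<noteq> \<zero>\<^bsub>M\<^esub>}"
  shows "f = g"
  using mod_grading assms
  by (auto simp: internal_direct_sum_def bij_betw_def dest: inj_onD)

lemma gr_submoduleI:
  assumes N: "additive_subgroup N M"
    and act: "\<And>x r. x \<in> N \<Longrightarrow> r \<in> carrier R \<Longrightarrow> ract M x r \<in> N"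
    and gen: "\<And>S. additive_subgroup S M \<Longrightarrow> (\<And>\<sigma>. \<sigma> \<in> carrier \<Gamma> \<Longrightarrow> N \<inter> homog M \<sigma> \<subseteq> S) \<Longrightarrow> N \<subseteq> S"
  shows "gr_submodule \<Gamma> R M N"
proof -
  let ?sum = "\<lambda>f. finsum M f {i. f i \<noteq> \<zero>\<^bsub>M\<^esub>}"
  define A where "A \<sigma> = N \<inter> homog M \<sigma>" for \<sigma>
  define F where "F = direct_sum_families M (carrier \<Gamma>) A"
  have A: "additive_subgroup (A \<sigma>) M" if "\<sigma> \<in> carrier \<Gamma>" for \<sigma>
    unfolding A_def
    using additive_subgroup.a_subgroup[OF N] additive_subgroup.a_subgroup[OF homog_subgroup[OF that]]
    by (intro additive_subgroupI M.add.subgroups_Inter_pair)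
  have F_carrier: "f \<sigma> \<in> carrier M" if "f \<in> F" for f \<sigma>
  proof (cases "\<sigma> \<in> carrier \<Gamma>")
    case True
    then have "f \<sigma> \<in> A \<sigma>" using that by (simp add: F_def direct_sum_families_def)
    then show ?thesis using additive_subgroup.a_subset[OF A[OF True]] by auto
  qed (use that in \<open>simp add: F_def direct_sum_families_def\<close>)
  have sub: "F \<subseteq> direct_sum_families M (carrier \<Gamma>) (homog M)"
    by (auto simp: F_def A_def direct_sum_families_def)
  have "additive_subgroup (?sum ` F) M"
  proof (rule additive_subgroupI'[OF M.abelian_group_axioms])
    show "?sum ` F \<subseteq> carrier M" using F_carrier by (auto intro!: M.finsum_closed)
    have "(\<lambda>_. \<zero>\<^bsub>M\<^esub>) \<in> F"
      using A by (auto simp: F_def direct_sum_families_def additive_subgroup.zero_closed)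
    moreover have "?sum (\<lambda>_. \<zero>\<^bsub>M\<^esub>) = \<zero>\<^bsub>M\<^esub>" by simp
    ultimately show "\<zero>\<^bsub>M\<^esub> \<in> ?sum ` F" by force
  next
    fix x y assume "x \<in> ?sum ` F" "y \<in> ?sum ` F"
    then obtain f g where f: "f \<in> F" "x = ?sum f" and g: "g \<in> F" "y = ?sum g" by blast
    define h where "h \<sigma> = f \<sigma> \<oplus>\<^bsub>M\<^esub> g \<sigma>" for \<sigma>
    let ?S = "{i. f i \<noteq> \<zero>\<^bsub>M\<^esub>} \<union> {i. g i \<noteq> \<zero>\<^bsub>M\<^esub>}"
    have fin: "finite ?S" using f g by (auto simp: F_def direct_sum_families_def)
    have hS: "{i. h i \<noteq> \<zero>\<^bsub>M\<^esub>} \<subseteq> ?S" by (auto simp: h_def)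
    have hF: "h \<in> F"
      using f(1) g(1) A finite_subset[OF hS fin]
      by (auto simp: F_def direct_sum_families_def h_def additive_subgroup.a_closed)
    have "?sum h = finsum M h ?S"
      by (rule finsum_support[OF M.abelian_group_axioms fin hS]) (use F_carrier hF in auto)
    also have "\<dots> = finsum M f ?S \<oplus>\<^bsub>M\<^esub> finsum M g ?S"
      unfolding h_def using F_carrier f g by (intro M.finsum_addf) auto
    also have "finsum M f ?S = x" unfolding f(2)
      by (rule finsum_support[symmetric, OF M.abelian_group_axioms fin]) (use F_carrier f in auto)
    also have "finsum M g ?S = y" unfolding g(2)
      by (rule finsum_support[symmetric, OF M.abelian_group_axioms fin]) (use F_carrier g in auto)
    finally show "x \<oplus>\<^bsub>M\<^esub> y \<in> ?sum ` F" using hF by force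
  next
    fix x assume "x \<in> ?sum ` F"
    then obtain f where f: "f \<in> F" "x = ?sum f" by blast
    define h where "h \<sigma> = \<ominus>\<^bsub>M\<^esub> f \<sigma>" for \<sigma>
    have supp: "{i. h i \<noteq> \<zero>\<^bsub>M\<^esub>} = {i. f i \<noteq> \<zero>\<^bsub>M\<^esub>}"
      using F_carrier[OF f(1)] M.add.inv_eq_1_iff by (auto simp: h_def)
    have hF: "h \<in> F"
      using f(1) A unfolding F_def direct_sum_families_def mem_Collect_eq supp
      by (auto simp: h_def additive_subgroup.a_inv_closed)
    have "\<ominus>\<^bsub>M\<^esub> x = finsum M (\<lambda>i. \<ominus>\<^bsub>M\<^esub> f i) {i. f i \<noteq> \<zero>\<^bsub>M\<^esub>}"
      unfolding f(2)
      by (rule additive_hom_finsum(2)[OF M.abelian_group_axioms M.abelian_group_axioms])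
        (use F_carrier[OF f(1)] in \<open>auto simp: M.minus_add M.a_comm\<close>)
    also have "\<dots> = ?sum h" unfolding supp by (simp add: h_def[abs_def])
    finally show "\<ominus>\<^bsub>M\<^esub> x \<in> ?sum ` F" using hF by force
  qed
  moreover have "A \<sigma> \<subseteq> ?sum ` F" if \<sigma>: "\<sigma> \<in> carrier \<Gamma>" for \<sigma>
  proof
    fix x assume x: "x \<in> A \<sigma>"
    define f where "f = (\<lambda>_. \<zero>\<^bsub>M\<^esub>)(\<sigma> := x)"
    have xc: "x \<in> carrier M" using x additive_subgroup.a_subset[OF A[OF \<sigma>]] by auto
    have sf: "{i. f i \<noteq> \<zero>\<^bsub>M\<^esub>} \<subseteq> {\<sigma>}" by (auto simp: f_def)
    have fF: "f \<in> F"
      using x \<sigma> A finite_subset[OF sf]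
      by (auto simp: F_def direct_sum_families_def f_def additive_subgroup.zero_closed)
    have "?sum f = finsum M f {\<sigma>}"
      by (rule finsum_support[OF M.abelian_group_axioms _ sf]) (use xc in \<open>auto simp: f_def\<close>)
    also have "\<dots> = x" using xc by (simp add: M.finsum_insert f_def)
    finally show "x \<in> ?sum ` F" using fF by force
  qed
  ultimately have "N \<subseteq> ?sum ` F" by (intro gen) (auto simp: A_def)
  moreover have "?sum ` F \<subseteq> N"
  proof
    fix x assume "x \<in> ?sum ` F"
    then obtain f where f: "f \<in> F" "x = ?sum f" by blast
    have "f \<sigma> \<in> N" for \<sigma>
      using f(1) additive_subgroup.zero_closed[OF N]
      by (cases "\<sigma> \<in> carrier \<Gamma>") (auto simp: F_def direct_sum_families_def A_def)
    then show "x \<in> N" unfolding f(2)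
      by (intro additive_subgroup_finsum[OF M.abelian_group_axioms N]) auto
  qed
  moreover have "inj_on ?sum F"
    using mod_grading sub by (auto simp: internal_direct_sum_def bij_betw_def intro: inj_on_subset)
  ultimately have "internal_direct_sum M (carrier \<Gamma>) A N"
    using A by (auto simp: internal_direct_sum_def bij_betw_def F_def)
  then show ?thesis
    using N act by (auto simp: gr_submodule_def A_def[abs_def])
qed

text \<open>A graded submodule can be copied onto any set it is in bijection with.\<close>

lemma transport:
  fixes \<psi> :: "'t \<Rightarrow> 'm"
  assumes S: "gr_submodule \<Gamma> R M S" and \<psi>: "bij_betw \<psi> C S"
  obtains T :: "('t, 'g, 'r) graded_rmod"
  where "graded_right_module \<Gamma> R T" "carrier T = C" "\<psi> \<in> gr_hom \<Gamma> R T M"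
    "\<And>\<sigma>. homog T \<sigma> = {x \<in> C. \<psi> x \<in> homog M \<sigma>}"
proof -
  define \<phi> where "\<phi> = inv_into C \<psi>"
  have \<phi>C: "\<phi> x \<in> C" and \<psi>\<phi>: "\<psi> (\<phi> x) = x" if "x \<in> S" for x
    using that \<psi> by (auto simp: \<phi>_def bij_betw_def inv_into_into f_inv_into_f)
  have \<phi>\<psi>: "\<phi> (\<psi> x) = x" and \<psi>S: "\<psi> x \<in> S" if "x \<in> C" for x
    using that \<psi> by (auto simp: \<phi>_def bij_betw_def)
  have inj: "x = y" if "x \<in> C" "y \<in> C" "\<psi> x = \<psi> y" for x y using that \<phi>\<psi> by metis
  have Ssub: "additive_subgroup S M" and Sact: "\<And>x r. x \<in> S \<Longrightarrow> r \<in> carrier R \<Longrightarrow> ract M x r \<in> S"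
    and Sdir: "internal_direct_sum M (carrier \<Gamma>) (\<lambda>\<gamma>. S \<inter> homog M \<gamma>) S"
    using S by (auto simp: gr_submodule_def)
  interpret S: additive_subgroup S M by fact
  have SM: "x \<in> S \<Longrightarrow> x \<in> carrier M" for x using S.a_subset by auto
  define T :: "('t, 'g, 'r) graded_rmod" where
    "T = \<lparr>carrier = C, mult = undefined, one = undefined, zero = \<phi> \<zero>\<^bsub>M\<^esub>,
      add = (\<lambda>x y. \<phi> (\<psi> x \<oplus>\<^bsub>M\<^esub> \<psi> y)), homog = (\<lambda>\<sigma>. {x \<in> C. \<psi> x \<in> homog M \<sigma>}),
      ract = (\<lambda>x r. \<phi> (ract M (\<psi> x) r))\<rparr>"
  have sel: "carrier T = C" "zero T = \<phi> \<zero>\<^bsub>M\<^esub>" "homog T = (\<lambda>\<sigma>. {x \<in> C. \<psi> x \<in> homog M \<sigma>})"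
    "x \<oplus>\<^bsub>T\<^esub> y = \<phi> (\<psi> x \<oplus>\<^bsub>M\<^esub> \<psi> y)" "ract T x r = \<phi> (ract M (\<psi> x) r)" for x y r
    by (simp_all add: T_def)
  have add_C: "x \<oplus>\<^bsub>T\<^esub> y \<in> C" "\<psi> (x \<oplus>\<^bsub>T\<^esub> y) = \<psi> x \<oplus>\<^bsub>M\<^esub> \<psi> y" if "x \<in> C" "y \<in> C" for x y
    using that by (simp_all add: sel \<phi>C \<psi>\<phi> \<psi>S)
  have act_C: "ract T x r \<in> C" "\<psi> (ract T x r) = ract M (\<psi> x) r" if "x \<in> C" "r \<in> carrier R" for x r
    using that by (simp_all add: sel \<phi>C \<psi>\<phi> \<psi>S Sact)
  have zero_C: "\<zero>\<^bsub>T\<^esub> \<in> C" "\<psi> \<zero>\<^bsub>T\<^esub> = \<zero>\<^bsub>M\<^esub>" by (simp_all add: sel \<phi>C \<psi>\<phi>)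
  have \<psi>M: "\<psi> x \<in> carrier M" if "x \<in> C" for x using that SM \<psi>S by blast
  have \<psi>0: "\<psi> x = \<zero>\<^bsub>M\<^esub> \<longleftrightarrow> x = \<zero>\<^bsub>T\<^esub>" if "x \<in> C" for x
    using that zero_C inj by metis
  have TG: "abelian_group T"
  proof (rule abelian_groupI)
    fix x assume "x \<in> carrier T"
    then have x: "x \<in> C" by (simp add: sel)
    show "\<exists>y\<in>carrier T. y \<oplus>\<^bsub>T\<^esub> x = \<zero>\<^bsub>T\<^esub>"
    proof (intro bexI[of _ "\<phi> (\<ominus>\<^bsub>M\<^esub> \<psi> x)"])
      show "\<phi> (\<ominus>\<^bsub>M\<^esub> \<psi> x) \<in> carrier T" using x by (simp add: sel \<phi>C \<psi>S)
      show "\<phi> (\<ominus>\<^bsub>M\<^esub> \<psi> x) \<oplus>\<^bsub>T\<^esub> x = \<zero>\<^bsub>T\<^esub>"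
        using x by (simp add: sel \<psi>\<phi> \<psi>S \<psi>M M.l_neg)
    qed
  qed (auto simp: add_C zero_C \<psi>M M.a_ac sel(1) intro!: inj)
  have \<psi>_finsum: "\<psi> (finsum T f A) = finsum M (\<lambda>i. \<psi> (f i)) A" if "f \<in> A \<rightarrow> C" for f and A :: "'g set"
    using additive_hom_finsum(2)[OF TG M.abelian_group_axioms, of \<psi> f A] that
    by (simp add: sel(1) \<psi>M add_C Pi_def)
  have finsum_C: "finsum T f A \<in> C" if "f \<in> A \<rightarrow> C" for f and A :: "'g set"
    using abelian_monoid.finsum_closed[OF abelian_group.axioms(1)[OF TG]] that by (simp add: sel(1))
  let ?FT = "direct_sum_families T (carrier \<Gamma>) (homog T)"
  let ?FM = "direct_sum_families M (carrier \<Gamma>) (\<lambda>\<gamma>. S \<inter> homog M \<gamma>)"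
  have FT_C: "f \<sigma> \<in> C" if "f \<in> ?FT" for f \<sigma>
    using that zero_C by (cases "\<sigma> \<in> carrier \<Gamma>") (auto simp: direct_sum_families_def sel(3))
  have FT_supp: "{i. \<psi> (f i) \<noteq> \<zero>\<^bsub>M\<^esub>} = {i. f i \<noteq> \<zero>\<^bsub>T\<^esub>}" if "\<And>i. f i \<in> C" for f :: "'g \<Rightarrow> 't"
    using \<psi>0 that by auto
  have FT_FM: "(\<lambda>i. \<psi> (f i)) \<in> ?FM" if "f \<in> ?FT" for f
  proof -
    have "\<forall>i. i \<notin> carrier \<Gamma> \<longrightarrow> \<psi> (f i) = \<zero>\<^bsub>M\<^esub>"
      using that zero_C by (auto simp: direct_sum_families_def)
    moreover have "finite {i. \<psi> (f i) \<noteq> \<zero>\<^bsub>M\<^esub>}"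
      using that unfolding FT_supp[OF FT_C[OF that]] by (auto simp: direct_sum_families_def)
    moreover have "\<forall>i\<in>carrier \<Gamma>. \<psi> (f i) \<in> S \<inter> homog M i"
      using that \<psi>S by (auto simp: direct_sum_families_def sel(3))
    ultimately show ?thesis unfolding direct_sum_families_def by blast
  qed
  have inj_M: "inj_on (\<lambda>f. finsum M f {i. f i \<noteq> \<zero>\<^bsub>M\<^esub>}) ?FM"
    and im_M: "(\<lambda>f. finsum M f {i. f i \<noteq> \<zero>\<^bsub>M\<^esub>}) ` ?FM = S"
    using Sdir by (auto simp: internal_direct_sum_def bij_betw_def)
  have sum_eq: "\<psi> (finsum T f {i. f i \<noteq> \<zero>\<^bsub>T\<^esub>}) =
      finsum M (\<lambda>i. \<psi> (f i)) {i. \<psi> (f i) \<noteq> \<zero>\<^bsub>M\<^esub>}" if "\<And>i. f i \<in> C" for f :: "'g \<Rightarrow> 't"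
    unfolding FT_supp[OF that] by (rule \<psi>_finsum) (use that in auto)
  have "bij_betw (\<lambda>f. finsum T f {i. f i \<noteq> \<zero>\<^bsub>T\<^esub>}) ?FT C"
    unfolding bij_betw_def
  proof (intro conjI inj_onI equalityI subsetI)
    fix f g assume f: "f \<in> ?FT" and g: "g \<in> ?FT"
      and eq: "finsum T f {i. f i \<noteq> \<zero>\<^bsub>T\<^esub>} = finsum T g {i. g i \<noteq> \<zero>\<^bsub>T\<^esub>}"
    have "(\<lambda>i. \<psi> (f i)) = (\<lambda>i. \<psi> (g i))"
      using arg_cong[OF eq, of \<psi>] unfolding sum_eq[OF FT_C[OF f]] sum_eq[OF FT_C[OF g]]
      by (rule inj_onD[OF inj_M _ FT_FM[OF f] FT_FM[OF g]])
    then have "f i = g i" for i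
      using FT_C[OF f] FT_C[OF g] by (intro inj) (auto dest: fun_cong)
    then show "f = g" by blast
  next
    fix x assume "x \<in> (\<lambda>f. finsum T f {i. f i \<noteq> \<zero>\<^bsub>T\<^esub>}) ` ?FT"
    then show "x \<in> C" using FT_C finsum_C by auto
  next
    fix x assume x: "x \<in> C"
    then obtain f where f: "f \<in> ?FM" "\<psi> x = finsum M f {i. f i \<noteq> \<zero>\<^bsub>M\<^esub>}"
      using \<psi>S im_M by blast
    have fS: "f i \<in> S" for i
      using f(1) by (cases "i \<in> carrier \<Gamma>") (auto simp: direct_sum_families_def)
    define f' where "f' i = \<phi> (f i)" for i
    have \<psi>f': "\<psi> (f' i) = f i" "f' i \<in> C" for i using fS by (simp_all add: f'_def \<psi>\<phi> \<phi>C)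
    have supp: "{i. f' i \<noteq> \<zero>\<^bsub>T\<^esub>} = {i. f i \<noteq> \<zero>\<^bsub>M\<^esub>}"
      using FT_supp[of f'] \<psi>f' by simp
    have "f' i = \<zero>\<^bsub>T\<^esub>" if "i \<notin> carrier \<Gamma>" for i
      using that f(1) by (simp add: f'_def sel direct_sum_families_def)
    moreover have "finite {i. f' i \<noteq> \<zero>\<^bsub>T\<^esub>}" unfolding supp using f(1)
      by (simp add: direct_sum_families_def)
    moreover have "f' i \<in> homog T i" if "i \<in> carrier \<Gamma>" for i
      using that f(1) \<psi>f' by (simp add: sel direct_sum_families_def)
    ultimately have "f' \<in> ?FT" by (simp add: direct_sum_families_def)
    moreover have "x = finsum T f' {i. f' i \<noteq> \<zero>\<^bsub>T\<^esub>}"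
      using sum_eq[of f'] \<psi>f' f(2) x finsum_C by (intro inj) auto
    ultimately show "x \<in> (\<lambda>f. finsum T f {i. f i \<noteq> \<zero>\<^bsub>T\<^esub>}) ` ?FT" by blast
  qed
  moreover have "additive_subgroup (homog T \<sigma>) T" if \<sigma>: "\<sigma> \<in> carrier \<Gamma>" for \<sigma>
  proof (rule additive_subgroupI'[OF TG])
    interpret H: additive_subgroup "homog M \<sigma>" M by (rule homog_subgroup[OF \<sigma>])
    show "homog T \<sigma> \<subseteq> carrier T" by (auto simp: sel)
    show "\<zero>\<^bsub>T\<^esub> \<in> homog T \<sigma>" using zero_C by (simp add: sel(3))
    show "x \<oplus>\<^bsub>T\<^esub> y \<in> homog T \<sigma>" if "x \<in> homog T \<sigma>" "y \<in> homog T \<sigma>" for x y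
      using that add_C by (simp add: sel(3))
    show "\<ominus>\<^bsub>T\<^esub> x \<in> homog T \<sigma>" if "x \<in> homog T \<sigma>" for x
    proof -
      have x: "x \<in> C" "\<psi> x \<in> homog M \<sigma>" using that by (auto simp: sel(3))
      have mx: "\<ominus>\<^bsub>T\<^esub> x \<in> C" using abelian_group.a_inv_closed[OF TG] x by (simp add: sel(1))
      have "\<psi> (\<ominus>\<^bsub>T\<^esub> x) \<oplus>\<^bsub>M\<^esub> \<psi> x = \<zero>\<^bsub>M\<^esub>"
        using add_C(2)[OF mx x(1)] abelian_group.l_neg[OF TG, of x] x zero_C by (simp add: sel(1))
      then have "\<psi> (\<ominus>\<^bsub>T\<^esub> x) = \<ominus>\<^bsub>M\<^esub> \<psi> x" using mx x by (simp add: M.minus_equality \<psi>M)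
      then show ?thesis using mx x by (simp add: sel(3))
    qed
  qed
  ultimately have T_dir: "internal_direct_sum T (carrier \<Gamma>) (homog T) (carrier T)"
    by (simp add: internal_direct_sum_def sel(1))
  have T: "graded_right_module \<Gamma> R T"
  proof (intro graded_right_module.intro graded_right_module_axioms.intro)
    show "graded_ring \<Gamma> R" by (rule graded_ring_axioms)
    show "abelian_group T" by (rule TG)
    show "internal_direct_sum T (carrier \<Gamma>) (homog T) (carrier T)" by (rule T_dir)
  next
    fix x r s assume "x \<in> carrier T" "r \<in> carrier R" "s \<in> carrier R"
    then show "ract T x (r \<oplus>\<^bsub>R\<^esub> s) = ract T x r \<oplus>\<^bsub>T\<^esub> ract T x s"
      "ract T x (r \<otimes>\<^bsub>R\<^esub> s) = ract T (ract T x r) s"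
      using m_closed by (auto intro!: inj simp: sel(1) act_C add_C \<psi>M ract_add_right ract_assoc)
  next
    fix x y r assume "x \<in> carrier T" "y \<in> carrier T" "r \<in> carrier R"
    then show "ract T (x \<oplus>\<^bsub>T\<^esub> y) r = ract T x r \<oplus>\<^bsub>T\<^esub> ract T y r"
      by (auto intro!: inj simp: sel(1) act_C add_C \<psi>M ract_add_left)
  next
    fix x r assume "x \<in> carrier T" "r \<in> carrier R"
    then show "ract T x r \<in> carrier T" by (simp add: sel(1) act_C)
  next
    fix \<sigma> \<tau> x r assume *: "\<sigma> \<in> carrier \<Gamma>" "\<tau> \<in> carrier \<Gamma>" "x \<in> homog T \<sigma>" "r \<in> homog R \<tau>"
    then have **: "x \<in> C" "\<psi> x \<in> homog M \<sigma>" "r \<in> carrier R"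
      using ring_homog_carrier by (auto simp: sel(3))
    show "ract T x r \<in> homog T (cmp \<Gamma> \<sigma> \<tau>)" if "src \<Gamma> \<sigma> = tgt \<Gamma> \<tau>"
      using homog_ract[OF *(1,2) that **(2) *(4)] ** by (simp add: sel(3) act_C)
    show "ract T x r = \<zero>\<^bsub>T\<^esub>" if "src \<Gamma> \<sigma> \<noteq> tgt \<Gamma> \<tau>"
      using homog_ract_zero[OF *(1,2) that **(2) *(4)] **
      by (intro inj) (simp_all add: act_C zero_C)
  next
    fix \<sigma> x assume *: "\<sigma> \<in> carrier \<Gamma>" "x \<in> homog T \<sigma>"
    then have **: "x \<in> C" "\<psi> x \<in> homog M \<sigma>" by (auto simp: sel(3))
    have "obj_one R (src \<Gamma> \<sigma>) \<in> carrier R" using * by (intro obj_one_carrier) (auto simp: identities_def)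
    then show "ract T x (obj_one R (src \<Gamma> \<sigma>)) = x"
      using ract_obj_one[OF *(1) **(2)] ** by (intro inj) (simp_all add: act_C)
  qed
  have "\<psi> \<in> gr_hom \<Gamma> R T M"
    by (auto simp: gr_hom_def sel(1,3) add_C act_C \<psi>M)
  with T show thesis by (intro that[of T]) (simp_all add: sel)
qed

end

lemma gr_homD:
  assumes "g \<in> gr_hom \<Gamma> R M N"
  shows "g \<in> carrier M \<rightarrow> carrier N"
    and "x \<in> carrier M \<Longrightarrow> g x \<in> carrier N"
    and "x \<in> carrier M \<Longrightarrow> y \<in> carrier M \<Longrightarrow> g (x \<oplus>\<^bsub>M\<^esub> y) = g x \<oplus>\<^bsub>N\<^esub> g y"
    and "x \<in> carrier M \<Longrightarrow> r \<in> carrier R \<Longrightarrow> g (ract M x r) = ract N (g x) r"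
    and "\<sigma> \<in> carrier \<Gamma> \<Longrightarrow> x \<in> homog M \<sigma> \<Longrightarrow> g x \<in> homog N \<sigma>"
  using assms by (auto simp: gr_hom_def image_subset_iff)

lemma image_additive_subgroup:
  assumes G: "abelian_group G" and H: "abelian_group H" and S: "additive_subgroup S G"
    and u: "u \<in> carrier G \<rightarrow> carrier H"
    and add: "\<And>x y. x \<in> carrier G \<Longrightarrow> y \<in> carrier G \<Longrightarrow> u (x \<oplus>\<^bsub>G\<^esub> y) = u x \<oplus>\<^bsub>H\<^esub> u y"
  shows "additive_subgroup (u ` S) H"
proof -
  interpret G: abelian_group G by fact
  interpret H: abelian_group H by fact
  interpret S: additive_subgroup S G by fact
  have SG: "x \<in> S \<Longrightarrow> x \<in> carrier G" for x using S.a_subset by auto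
  have zero: "u \<zero>\<^bsub>G\<^esub> = \<zero>\<^bsub>H\<^esub>" by (rule additive_hom_zero[OF G H u]) (rule add)
  show ?thesis
  proof (rule additive_subgroupI'[OF H])
    show "u ` S \<subseteq> carrier H" using u SG by auto
    show "\<zero>\<^bsub>H\<^esub> \<in> u ` S" by (rule image_eqI[of _ _ "\<zero>\<^bsub>G\<^esub>"]) (simp_all add: zero)
    show "x \<oplus>\<^bsub>H\<^esub> y \<in> u ` S" if "x \<in> u ` S" "y \<in> u ` S" for x y
    proof -
      obtain s t where "s \<in> S" "x = u s" "t \<in> S" "y = u t" using \<open>x \<in> u ` S\<close> \<open>y \<in> u ` S\<close> by blast
      then show ?thesis by (intro image_eqI[of _ _ "s \<oplus>\<^bsub>G\<^esub> t"]) (simp_all add: add SG)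
    qed
    show "\<ominus>\<^bsub>H\<^esub> x \<in> u ` S" if x: "x \<in> u ` S" for x
    proof -
      obtain s where s: "s \<in> S" "x = u s" using x by blast
      have "u (\<ominus>\<^bsub>G\<^esub> s) \<oplus>\<^bsub>H\<^esub> x = \<zero>\<^bsub>H\<^esub>"
        using add[of "\<ominus>\<^bsub>G\<^esub> s" s] SG[OF s(1)] zero s(2) by (simp add: G.l_neg)
      then have "\<ominus>\<^bsub>H\<^esub> x = u (\<ominus>\<^bsub>G\<^esub> s)"
        using SG[OF s(1)] u s(2) by (intro H.minus_equality) auto
      then show ?thesis using s by auto
    qed
  qed
qed

lemma preimage_additive_subgroup:
  assumes G: "abelian_group G" and H: "abelian_group H" and S: "additive_subgroup S H"
    and u: "u \<in> carrier G \<rightarrow> carrier H"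
    and add: "\<And>x y. x \<in> carrier G \<Longrightarrow> y \<in> carrier G \<Longrightarrow> u (x \<oplus>\<^bsub>G\<^esub> y) = u x \<oplus>\<^bsub>H\<^esub> u y"
  shows "additive_subgroup {x \<in> carrier G. u x \<in> S} G"
proof -
  interpret G: abelian_group G by fact
  interpret H: abelian_group H by fact
  interpret S: additive_subgroup S H by fact
  have zero: "u \<zero>\<^bsub>G\<^esub> = \<zero>\<^bsub>H\<^esub>" by (rule additive_hom_zero[OF G H u]) (rule add)
  show ?thesis
  proof (rule additive_subgroupI'[OF G])
    fix x assume x: "x \<in> {x \<in> carrier G. u x \<in> S}"
    then have "u (\<ominus>\<^bsub>G\<^esub> x) \<oplus>\<^bsub>H\<^esub> u x = \<zero>\<^bsub>H\<^esub>"
      using add[of "\<ominus>\<^bsub>G\<^esub> x" x] zero by (simp add: G.l_neg)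
    then have "\<ominus>\<^bsub>H\<^esub> u x = u (\<ominus>\<^bsub>G\<^esub> x)"
      using x u by (intro H.minus_equality) auto
    then show "\<ominus>\<^bsub>G\<^esub> x \<in> {x \<in> carrier G. u x \<in> S}"
      using x S.a_inv_closed[of "u x"] by auto
  qed (auto simp: zero add)
qed

theorem gr_projective_lifting:
  fixes P :: "('p, 'g, 'r) graded_rmod"
    and M :: "('m, 'g, 'r) graded_rmod" and N :: "('n, 'g, 'r) graded_rmod"
  assumes P: "graded_right_module \<Gamma> R P" and proj: "gr_projective \<Gamma> R P"
    and M: "graded_right_module \<Gamma> R M" and N: "graded_right_module \<Gamma> R N"
  shows "gr_lifting \<Gamma> R P M N"
  unfolding gr_lifting_def
proof (intro ballI impI)
  fix g h assume g: "g \<in> gr_hom \<Gamma> R M N" and h: "h \<in> gr_hom \<Gamma> R P N" and surj: "g ` carrier M = carrier N"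
  interpret P: graded_right_module \<Gamma> R P by fact
  interpret M: graded_right_module \<Gamma> R M by fact
  interpret N: graded_right_module \<Gamma> R N by fact
  note PG = P.M.abelian_group_axioms and MG = M.M.abelian_group_axioms
    and NG = N.M.abelian_group_axioms
  note gD = gr_homD[OF g] and hD = gr_homD[OF h]
  have g0: "g \<zero>\<^bsub>M\<^esub> = \<zero>\<^bsub>N\<^esub>" by (rule additive_hom_zero[OF MG NG gD(1,3)])
  define H where "H = (\<Union>\<sigma>\<in>carrier \<Gamma>. homog P \<sigma>)"
  have HP: "p \<in> H \<Longrightarrow> p \<in> carrier P" for p using P.homog_carrier by (auto simp: H_def)

  text \<open>Homogeneous lifts of the images of homogeneous elements of \<open>P\<close>.\<close>
  have "\<exists>m \<sigma>. \<sigma> \<in> carrier \<Gamma> \<and> p \<in> homog P \<sigma> \<and> m \<in> homog M \<sigma> \<and> g m = h p" if pH: "p \<in> H" for p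
  proof -
    obtain \<sigma> where \<sigma>: "\<sigma> \<in> carrier \<Gamma>" "p \<in> homog P \<sigma>" using pH by (auto simp: H_def)
    have hp: "h p \<in> homog N \<sigma>" "h p \<in> carrier N" using hD \<sigma> HP that by auto
    obtain m where m: "m \<in> carrier M" "g m = h p" using surj hp(2) by (metis image_iff)
    obtain f where f: "\<And>\<sigma>. \<sigma> \<in> carrier \<Gamma> \<Longrightarrow> f \<sigma> \<in> homog M \<sigma>" "finite {\<sigma>. f \<sigma> \<noteq> \<zero>\<^bsub>M\<^esub>}"
      "{\<sigma>. f \<sigma> \<noteq> \<zero>\<^bsub>M\<^esub>} \<subseteq> carrier \<Gamma>" "m = finsum M f {\<sigma>. f \<sigma> \<noteq> \<zero>\<^bsub>M\<^esub>}"
      using M.decompose[OF m(1)] by blast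
    have fM: "f i \<in> carrier M" for i
      using f(1,3) M.homog_carrier by (cases "f i = \<zero>\<^bsub>M\<^esub>") auto
    define f1 where "f1 i = g (f i)" for i
    define f2 where "f2 = (\<lambda>_. \<zero>\<^bsub>N\<^esub>)(\<sigma> := h p)"
    have s1: "{i. f1 i \<noteq> \<zero>\<^bsub>N\<^esub>} \<subseteq> {\<sigma>. f \<sigma> \<noteq> \<zero>\<^bsub>M\<^esub>}" using g0 by (auto simp: f1_def)
    have s2: "{i. f2 i \<noteq> \<zero>\<^bsub>N\<^esub>} \<subseteq> {\<sigma>}" by (auto simp: f2_def)
    have "f1 = f2"
    proof (rule N.decomposition_unique)
      show "f1 \<in> direct_sum_families N (carrier \<Gamma>) (homog N)"
        using f(1,3) gD(5) s1 finite_subset[OF s1 f(2)] by (auto simp: direct_sum_families_def f1_def)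
      show "f2 \<in> direct_sum_families N (carrier \<Gamma>) (homog N)"
        using hp \<sigma> finite_subset[OF s2]
        by (auto simp: direct_sum_families_def f2_def additive_subgroup.zero_closed[OF N.homog_subgroup])
      have "finsum N f1 {\<sigma>. f1 \<sigma> \<noteq> \<zero>\<^bsub>N\<^esub>} = finsum N f1 {\<sigma>. f \<sigma> \<noteq> \<zero>\<^bsub>M\<^esub>}"
        by (rule finsum_support[OF NG f(2) s1]) (use fM gD in \<open>auto simp: f1_def\<close>)
      also have "\<dots> = g m"
        unfolding f(4) f1_def
        by (rule additive_hom_finsum(2)[OF MG NG gD(1,3), symmetric]) (use fM in auto)
      also have "\<dots> = finsum N f2 {\<sigma>}"
        using hp m by (simp add: N.M.finsum_insert f2_def)
      also have "\<dots> = finsum N f2 {\<sigma>. f2 \<sigma> \<noteq> \<zero>\<^bsub>N\<^esub>}"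
        by (rule finsum_support[OF NG _ s2, symmetric]) (use hp in \<open>auto simp: f2_def\<close>)
      finally show "finsum N f1 {\<sigma>. f1 \<sigma> \<noteq> \<zero>\<^bsub>N\<^esub>} = finsum N f2 {\<sigma>. f2 \<sigma> \<noteq> \<zero>\<^bsub>N\<^esub>}" .
    qed
    then have "g (f \<sigma>) = h p" by (metis f1_def f2_def fun_upd_same)
    then show ?thesis using \<sigma> f(1) by blast
  qed
  then obtain m d where md: "\<And>p. p \<in> H \<Longrightarrow> d p \<in> carrier \<Gamma> \<and> p \<in> homog P (d p) \<and> m p \<in> homog M (d p) \<and> g (m p) = h p"
    by metis
  have mM: "m p \<in> carrier M" if "p \<in> H" for p using md[OF that] M.homog_carrier by blast

  define ev where "ev = (\<lambda>xs. foldr (\<lambda>(p, r) x. ract M (m p) r \<oplus>\<^bsub>M\<^esub> x) xs \<zero>\<^bsub>M\<^esub>)"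
  define L where "L = lists (H \<times> carrier R)"
  define M' where "M' = ev ` L"
  have ev_simps: "ev [] = \<zero>\<^bsub>M\<^esub>" "ev ((p, r) # xs) = ract M (m p) r \<oplus>\<^bsub>M\<^esub> ev xs" for p r xs
    by (simp_all add: ev_def)
  have ev_M: "ev xs \<in> carrier M" if "xs \<in> L" for xs
    using that unfolding L_def by (induction xs) (auto simp: ev_simps mM M.ract_closed)
  have ev_M2: "ev xs \<in> carrier M" if "\<forall>x\<in>set xs. x \<in> H \<times> carrier R" for xs
    using ev_M[of xs] that by (simp add: L_def in_lists_conv_set)
  have ev_append: "ev (xs @ ys) = ev xs \<oplus>\<^bsub>M\<^esub> ev ys" if "xs \<in> L" "ys \<in> L" for xs ys
    using that(1) ev_M[OF that(2)] unfolding L_def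
    by (induction xs) (auto simp: ev_simps mM M.ract_closed ev_M2 M.M.a_assoc)
  have neg0: "\<ominus>\<^bsub>M\<^esub> \<zero>\<^bsub>M\<^esub> = \<zero>\<^bsub>M\<^esub>" by (rule M.M.minus_equality) auto
  have ev_uminus: "ev (map (\<lambda>(p, r). (p, \<ominus>\<^bsub>R\<^esub> r)) xs) = \<ominus>\<^bsub>M\<^esub> ev xs" if "xs \<in> L" for xs
    using that unfolding L_def
    by (induction xs) (auto simp: ev_simps mM M.ract_closed ev_M2 M.ract_uminus M.M.minus_add neg0)
  have ev_act: "ev (map (\<lambda>(p, r). (p, r \<otimes>\<^bsub>R\<^esub> s)) xs) = ract M (ev xs) s"
    if "xs \<in> L" "s \<in> carrier R" for xs s
    using that unfolding L_def
    by (induction xs) (auto simp: ev_simps mM M.ract_closed ev_M2 M.ract_assoc M.ract_add_left M.ract_zero_left)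
  have M'_sub: "additive_subgroup M' M"
  proof (rule additive_subgroupI'[OF MG])
    show "M' \<subseteq> carrier M" using ev_M by (auto simp: M'_def)
    show "\<zero>\<^bsub>M\<^esub> \<in> M'" unfolding M'_def by (rule image_eqI[of _ _ "[]"]) (simp_all add: ev_simps L_def)
  next
    fix x y assume "x \<in> M'" "y \<in> M'"
    then obtain xs ys where "xs \<in> L" "ys \<in> L" "x = ev xs" "y = ev ys" by (auto simp: M'_def)
    then show "x \<oplus>\<^bsub>M\<^esub> y \<in> M'"
      unfolding M'_def using ev_append[of xs ys] by (intro image_eqI[of _ _ "xs @ ys"]) (auto simp: L_def)
  next
    fix x assume "x \<in> M'"
    then obtain xs where "xs \<in> L" "x = ev xs" by (auto simp: M'_def)
    moreover from this have "map (\<lambda>(p, r). (p, \<ominus>\<^bsub>R\<^esub> r)) xs \<in> L"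
      by (fastforce simp: L_def)
    ultimately show "\<ominus>\<^bsub>M\<^esub> x \<in> M'"
      unfolding M'_def using ev_uminus[of xs] by (metis image_eqI)
  qed
  have single: "ract M (m p) r \<in> M'" if "p \<in> H" "r \<in> carrier R" for p r
    unfolding M'_def
    by (rule image_eqI[of _ _ "[(p, r)]"]) (use that in \<open>auto simp: ev_simps L_def mM M.ract_closed\<close>)
  have M'_gen: "M' \<subseteq> S" if S: "additive_subgroup S M"
    and gen: "\<And>p r. p \<in> H \<Longrightarrow> r \<in> carrier R \<Longrightarrow> ract M (m p) r \<in> S" for S
  proof -
    have "ev xs \<in> S" if "xs \<in> L" for xs
      using that unfolding L_def
      by (induction xs) (auto simp: ev_simps gen additive_subgroup.zero_closed[OF S] additive_subgroup.a_closed[OF S])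
    then show ?thesis by (auto simp: M'_def)
  qed
  have M': "gr_submodule \<Gamma> R M M'"
  proof (rule M.gr_submoduleI[OF M'_sub])
    fix x r assume "x \<in> M'" and r: "r \<in> carrier R"
    then obtain xs where "xs \<in> L" "x = ev xs" by (auto simp: M'_def)
    moreover from this have "map (\<lambda>(p, s). (p, s \<otimes>\<^bsub>R\<^esub> r)) xs \<in> L"
      using r P.m_closed by (fastforce simp: L_def)
    ultimately show "ract M x r \<in> M'"
      unfolding M'_def using ev_act[of xs r] r by (metis image_eqI)
  next
    fix S assume S: "additive_subgroup S M" and hom: "\<And>\<sigma>. \<sigma> \<in> carrier \<Gamma> \<Longrightarrow> M' \<inter> homog M \<sigma> \<subseteq> S"
    show "M' \<subseteq> S"
    proof (rule M'_gen[OF S])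
      fix p r assume p: "p \<in> H" and r: "r \<in> carrier R"
      obtain f where f: "\<And>\<sigma>. \<sigma> \<in> carrier \<Gamma> \<Longrightarrow> f \<sigma> \<in> homog R \<sigma>" "finite {\<sigma>. f \<sigma> \<noteq> \<zero>\<^bsub>R\<^esub>}"
        "{\<sigma>. f \<sigma> \<noteq> \<zero>\<^bsub>R\<^esub>} \<subseteq> carrier \<Gamma>" "r = finsum R f {\<sigma>. f \<sigma> \<noteq> \<zero>\<^bsub>R\<^esub>}"
        using P.ring_decompose[OF r] by blast
      have fR: "f i \<in> carrier R" if "i \<in> carrier \<Gamma>" for i
        using f(1) that P.ring_homog_carrier by blast
      have "ract M (m p) (f i) \<in> S" if i: "i \<in> carrier \<Gamma>" for i
      proof (cases "src \<Gamma> (d p) = tgt \<Gamma> i")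
        case True
        have "ract M (m p) (f i) \<in> homog M (cmp \<Gamma> (d p) i)"
          using M.homog_ract[OF _ i True _ f(1)[OF i]] md[OF p] by blast
        moreover have "cmp \<Gamma> (d p) i \<in> carrier \<Gamma>" using P.cmp_closed i md[OF p] True by blast
        ultimately show ?thesis using hom single[OF p fR[OF i]] by blast
      next
        case False
        then have "ract M (m p) (f i) = \<zero>\<^bsub>M\<^esub>"
          using M.homog_ract_zero[OF _ i False _ f(1)[OF i]] md[OF p] by blast
        then show ?thesis using additive_subgroup.zero_closed[OF S] by simp
      qed
      then have "finsum M (\<lambda>i. ract M (m p) (f i)) {\<sigma>. f \<sigma> \<noteq> \<zero>\<^bsub>R\<^esub>} \<in> S"
        using f(3) by (intro additive_subgroup_finsum[OF MG S]) auto
      moreover have "ract M (m p) r = finsum M (\<lambda>i. ract M (m p) (f i)) {\<sigma>. f \<sigma> \<noteq> \<zero>\<^bsub>R\<^esub>}"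
        unfolding f(4)
        by (rule additive_hom_finsum(2)[OF P.abelian_group_axioms MG])
          (use f(3) fR mM[OF p] in \<open>auto simp: M.ract_closed M.ract_add_right\<close>)
      ultimately show "ract M (m p) r \<in> S" by simp
    qed
  qed

  define N' where "N' = h ` carrier P"
  have P_sub: "additive_subgroup (carrier P) P"
    by (rule additive_subgroupI'[OF PG]) auto
  have N'_sub: "additive_subgroup N' N"
    unfolding N'_def by (rule image_additive_subgroup[OF PG NG P_sub hD(1,3)])
  have P_gen: "carrier P \<subseteq> S" if S: "additive_subgroup S P" and H: "H \<subseteq> S" for S
  proof
    fix x assume x: "x \<in> carrier P"
    obtain f where f: "\<And>\<sigma>. \<sigma> \<in> carrier \<Gamma> \<Longrightarrow> f \<sigma> \<in> homog P \<sigma>" "finite {\<sigma>. f \<sigma> \<noteq> \<zero>\<^bsub>P\<^esub>}"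
      "{\<sigma>. f \<sigma> \<noteq> \<zero>\<^bsub>P\<^esub>} \<subseteq> carrier \<Gamma>" "x = finsum P f {\<sigma>. f \<sigma> \<noteq> \<zero>\<^bsub>P\<^esub>}"
      using P.decompose[OF x] by blast
    show "x \<in> S" unfolding f(4)
      by (rule additive_subgroup_finsum[OF PG S]) (use f(1,3) H in \<open>auto simp: H_def\<close>)
  qed
  have N'_gen: "N' \<subseteq> S" if S: "additive_subgroup S N" and H: "h ` H \<subseteq> S" for S
    using P_gen[OF preimage_additive_subgroup[OF PG NG S hD(1,3)]] H HP by (auto simp: N'_def)
  have N': "gr_submodule \<Gamma> R N N'"
  proof (rule N.gr_submoduleI[OF N'_sub])
    show "ract N x r \<in> N'" if "x \<in> N'" "r \<in> carrier R" for x r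
    proof -
      obtain p where "p \<in> carrier P" "x = h p" using \<open>x \<in> N'\<close> by (auto simp: N'_def)
      then show ?thesis using hD(4)[of p r] that P.ract_closed unfolding N'_def by (metis image_eqI)
    qed
    show "N' \<subseteq> S" if "additive_subgroup S N" "\<And>\<sigma>. \<sigma> \<in> carrier \<Gamma> \<Longrightarrow> N' \<inter> homog N \<sigma> \<subseteq> S" for S
      by (rule N'_gen[OF that(1)]) (use that(2) hD(5) HP in \<open>fastforce simp: H_def N'_def\<close>)
  qed

  have gM'_sub: "additive_subgroup (g ` M') N"
    by (rule image_additive_subgroup[OF MG NG M'_sub gD(1,3)])
  have gM': "g ` M' = N'"
  proof
    have "M' \<subseteq> {x \<in> carrier M. g x \<in> N'}"
    proof (rule M'_gen[OF preimage_additive_subgroup[OF MG NG N'_sub gD(1,3)]])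
      fix p r assume p: "p \<in> H" and r: "r \<in> carrier R"
      have "g (ract M (m p) r) = h (ract P p r)"
        using gD(4)[OF mM[OF p] r] hD(4)[OF HP[OF p] r] md[OF p] by simp
      then show "ract M (m p) r \<in> {x \<in> carrier M. g x \<in> N'}"
        using p r by (auto simp: N'_def mM HP M.ract_closed P.ract_closed)
    qed
    then show "g ` M' \<subseteq> N'" by auto
    show "N' \<subseteq> g ` M'"
    proof (rule N'_gen[OF gM'_sub], rule image_subsetI)
      fix p assume p: "p \<in> H"
      have e: "obj_one R (src \<Gamma> (d p)) \<in> carrier R"
        using md[OF p] by (intro P.obj_one_carrier) (auto simp: identities_def)
      have "ract M (m p) (obj_one R (src \<Gamma> (d p))) = m p" using M.ract_obj_one md[OF p] by blast
      with single[OF p e] have "m p \<in> M'" by simp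
      moreover have "h p = g (m p)" using md[OF p] by simp
      ultimately show "h p \<in> g ` M'" by blast
    qed
  qed

  text \<open>Both submodules fit into the type of test modules.\<close>
  obtain C1 where C1: "C1 \<subseteq> L" "inj_on ev C1" "M' = ev ` C1"
    unfolding M'_def using subset_image_inj[of "ev ` L" ev L] by blast
  define ev2 :: "('p \<times> 'r) list \<Rightarrow> 'n" where "ev2 = (\<lambda>xs. h (fst (hd xs)))"
  have "N' \<subseteq> ev2 ` UNIV"
  proof
    fix x assume "x \<in> N'"
    then obtain p where "x = h p" by (auto simp: N'_def)
    then have "x = ev2 [(p, undefined)]" by (simp add: ev2_def)
    then show "x \<in> ev2 ` UNIV" by blast
  qed
  then obtain C2 where C2: "inj_on ev2 C2" "N' = ev2 ` C2"
    using subset_image_inj[of N' ev2 UNIV] by blast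
  have bij1: "bij_betw ev C1 M'" and bij2: "bij_betw ev2 C2 N'"
    using C1 C2 by (simp_all add: bij_betw_def)
  obtain T1 :: "(('p \<times> 'r) list, 'g, 'r) graded_rmod" where T1: "graded_right_module \<Gamma> R T1" "carrier T1 = C1" "ev \<in> gr_hom \<Gamma> R T1 M"
    "\<And>\<sigma>. homog T1 \<sigma> = {x \<in> C1. ev x \<in> homog M \<sigma>}"
    by (rule M.transport[OF M' bij1], rule that)
  obtain T2 :: "(('p \<times> 'r) list, 'g, 'r) graded_rmod" where T2: "graded_right_module \<Gamma> R T2" "carrier T2 = C2" "ev2 \<in> gr_hom \<Gamma> R T2 N"
    "\<And>\<sigma>. homog T2 \<sigma> = {x \<in> C2. ev2 x \<in> homog N \<sigma>}"
    by (rule N.transport[OF N' bij2], rule that)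
  interpret T1: graded_right_module \<Gamma> R T1 by (rule T1)
  interpret T2: graded_right_module \<Gamma> R T2 by (rule T2)
  define \<phi> where "\<phi> = inv_into C2 ev2"
  have \<phi>: "\<phi> x \<in> C2" "ev2 (\<phi> x) = x" if "x \<in> N'" for x
    using that C2 by (auto simp: \<phi>_def inv_into_into f_inv_into_f)
  have inj2: "x = y" if "x \<in> C2" "y \<in> C2" "ev2 x = ev2 y" for x y using that C2(1) by (auto dest: inj_onD)
  note eD = gr_homD[OF T1(3), unfolded T1(2)] and e2D = gr_homD[OF T2(3), unfolded T2(2)]
  have T_simps: "x \<in> C2 \<Longrightarrow> y \<in> C2 \<Longrightarrow> x \<oplus>\<^bsub>T2\<^esub> y \<in> C2" "x \<in> C2 \<Longrightarrow> r \<in> carrier R \<Longrightarrow> ract T2 x r \<in> C2"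
    "u \<in> C1 \<Longrightarrow> v \<in> C1 \<Longrightarrow> u \<oplus>\<^bsub>T1\<^esub> v \<in> C1" "u \<in> C1 \<Longrightarrow> r \<in> carrier R \<Longrightarrow> ract T1 u r \<in> C1"
    for x y u v r
    using T2.M.a_closed T2.ract_closed T1.M.a_closed T1.ract_closed unfolding T1(2) T2(2) by blast+
  have gev: "g (ev x) \<in> N'" "ev x \<in> carrier M" if "x \<in> C1" for x using that gM' C1 eD(2) by auto
  have hN': "h p \<in> N'" if "p \<in> carrier P" for p using that by (auto simp: N'_def)
  have N'_closed: "x \<in> N' \<Longrightarrow> y \<in> N' \<Longrightarrow> x \<oplus>\<^bsub>N\<^esub> y \<in> N'" "x \<in> N' \<Longrightarrow> r \<in> carrier R \<Longrightarrow> ract N x r \<in> N'"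
    for x y r
    using additive_subgroup.a_closed[OF N'_sub] N' by (simp_all add: gr_submodule_def)
  define g2 where "g2 x = \<phi> (g (ev x))" for x
  define h2 where "h2 p = \<phi> (h p)" for p
  have g2_hom: "g2 \<in> gr_hom \<Gamma> R T1 T2"
    unfolding gr_hom_def T1(2) T2(2) T1(4) T2(4)
    by (auto simp: g2_def \<phi> gev N'_closed T_simps e2D eD gD intro!: inj2)
  have h2_hom: "h2 \<in> gr_hom \<Gamma> R P T2"
    unfolding gr_hom_def T2(2) T2(4)
    using P.homog_carrier by (auto simp: h2_def \<phi> hN' N'_closed T_simps e2D hD P.ract_closed intro!: inj2)
  have g2_surj: "g2 ` carrier T1 = carrier T2"
    unfolding T1(2) T2(2)
  proof
    show "g2 ` C1 \<subseteq> C2" by (auto simp: g2_def \<phi> gev)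
    show "C2 \<subseteq> g2 ` C1"
    proof
      fix y assume y: "y \<in> C2"
      then have "ev2 y \<in> g ` ev ` C1" using C2 gM' C1 by auto
      then obtain x where x: "x \<in> C1" "ev2 y = g (ev x)" by auto
      then have "y = g2 x" unfolding g2_def using y \<phi> gev by (intro inj2) auto
      then show "y \<in> g2 ` C1" using x by blast
    qed
  qed
  have "gr_lifting \<Gamma> R P T1 T2" using proj T1(1) T2(1) by (auto simp: gr_projective_def)
  then obtain k where k: "k \<in> gr_hom \<Gamma> R P T1" "\<And>x. x \<in> carrier P \<Longrightarrow> g2 (k x) = h2 x"
    unfolding gr_lifting_def using g2_hom h2_hom g2_surj by blast
  note kD = gr_homD[OF k(1), unfolded T1(2)]
  show "\<exists>h'\<in>gr_hom \<Gamma> R P M. \<forall>x\<in>carrier P. g (h' x) = h x"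
  proof (rule bexI[of _ "\<lambda>x. ev (k x)"], rule ballI)
    fix x assume x: "x \<in> carrier P"
    have "ev2 (g2 (k x)) = ev2 (h2 x)" using k(2)[OF x] by simp
    then show "g (ev (k x)) = h x"
      using \<phi>(2) gev kD(2)[OF x] hN'[OF x] by (simp add: g2_def h2_def)
  next
    show "(\<lambda>x. ev (k x)) \<in> gr_hom \<Gamma> R P M"
      unfolding gr_hom_def using kD eD by auto
  qed
qed

end

theory Submission
  imports Defs
begin

text \<open>
  Suppose that \<open>P\<close> has no gr-maximal graded submodule. Splitting a surjection onto \<open>P\<close> from a direct
  sum of shifted modules \<open>1\<^sub>e R\<close> gives a homogeneous dual basis, so that \<open>x = \<Sum> p\<^sub>i f\<^sub>i(x)\<close> is a finite
  sum for each \<open>x\<close> in \<open>P\<close>. For homogeneous \<open>p\<close> and a functional \<open>f\<close> of matching degree, the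
  gr-endomorphism \<open>x \<mapsto> x + p f(x)\<close> of \<open>P\<close> is invertible: if its image missed \<open>p\<close>, Zorn's lemma
  would give a gr-maximal submodule above it; so \<open>p\<close> has a right quasi-inverse for the product
  \<open>p * x = p f(x)\<close>, and applying this to the quasi-inverse shows that it is two-sided. Inverting \<open>x \<mapsto> x - p\<^sub>n f\<^sub>n(x)\<close> removes the last
  term from the expansion of \<open>x\<close>, at the cost of changing the other \<open>p\<^sub>i\<close>; by induction on the number
  of terms, \<open>x = 0\<close>.
\<close>

section \<open>Projections onto the summands of a direct sum\<close>

text \<open>The decomposition of \<open>x\<close> is obtained by inverting the bijection in
  \<open>internal_direct_sum\<close>, so the value has a meaning only for \<open>x\<close> in the
  summed carrier.\<close>

definition component ::
  "('a, 'k) ring_scheme \<Rightarrow> 'i set \<Rightarrow> ('i \<Rightarrow> 'a set) \<Rightarrow> 'i \<Rightarrow> 'a \<Rightarrow> 'a" where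
  "component G I A i x =
    inv_into (direct_sum_families G I A) (\<lambda>f. finsum G f {i. f i \<noteq> \<zero>\<^bsub>G\<^esub>}) x i"

text \<open>Instead of handling families directly, it is enough to exhibit candidate projections
  \<open>\<pi> i\<close> that separate points and have finite support at each element. This is how
  the gradings of shifted modules and of direct sums are established.\<close>

lemma internal_direct_sumI:
  fixes G (structure)
  assumes G: "abelian_group G"
    and A: "\<And>i. i \<in> I \<Longrightarrow> A i \<subseteq> carrier G"
    and in_A: "\<And>i x. i \<in> I \<Longrightarrow> x \<in> carrier G \<Longrightarrow> \<pi> i x \<in> A i"
    and add: "\<And>i x y. i \<in> I \<Longrightarrow> x \<in> carrier G \<Longrightarrow> y \<in> carrier G \<Longrightarrow> \<pi> i (x \<oplus> y) = \<pi> i x \<oplus> \<pi> i y"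
    and same: "\<And>i x. i \<in> I \<Longrightarrow> x \<in> A i \<Longrightarrow> \<pi> i x = x"
    and other: "\<And>i j x. i \<in> I \<Longrightarrow> j \<in> I \<Longrightarrow> i \<noteq> j \<Longrightarrow> x \<in> A i \<Longrightarrow> \<pi> j x = \<zero>"
    and fin: "\<And>x. x \<in> carrier G \<Longrightarrow> finite {i \<in> I. \<pi> i x \<noteq> \<zero>}"
    and sep: "\<And>x. x \<in> carrier G \<Longrightarrow> (\<And>i. i \<in> I \<Longrightarrow> \<pi> i x = \<zero>) \<Longrightarrow> x = \<zero>"
  shows "internal_direct_sum G I A (carrier G)"
proof -
  interpret G: abelian_group G by fact
  let ?F = "direct_sum_families G I A"
  let ?sum = "\<lambda>f. finsum G f {i. f i \<noteq> \<zero>}"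
  have \<pi>_closed: "\<pi> i \<in> carrier G \<rightarrow> carrier G" if "i \<in> I" for i
    using that in_A A by blast
  have \<pi>_zero: "\<pi> i \<zero> = \<zero>" if "i \<in> I" for i
    by (rule additive_hom_zero[OF G G \<pi>_closed[OF that]]) (use add[OF that] in auto)
  have \<pi>_minus: "\<pi> i (\<ominus> x) = \<ominus> \<pi> i x" if "i \<in> I" "x \<in> carrier G" for i x
  proof -
    have "\<pi> i (\<ominus> x) \<oplus> \<pi> i x = \<zero>"
      using that add[of i "\<ominus> x" x] by (simp add: G.l_neg \<pi>_zero)
    then show ?thesis
      using that \<pi>_closed[of i] by (intro G.minus_equality[symmetric]) auto
  qed
  have eqI: "x = y" if "x \<in> carrier G" "y \<in> carrier G" "\<And>i. i \<in> I \<Longrightarrow> \<pi> i x = \<pi> i y" for x y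
  proof -
    have "x \<oplus> \<ominus> y = \<zero>"
    proof (rule sep)
      fix i assume "i \<in> I"
      then show "\<pi> i (x \<oplus> \<ominus> y) = \<zero>"
        using that \<pi>_closed[of i] by (auto simp: add \<pi>_minus G.r_neg Pi_iff)
    qed (use that in auto)
    then have "\<ominus> (\<ominus> y) = x" using that by (intro G.minus_equality) auto
    then show ?thesis using that by simp
  qed
  \<comment> \<open>As the common kernel of the other projections, \<open>A i\<close> is a subgroup;
    this is why mere inclusion in the carrier is assumed of it.\<close>
  have A_kernel: "A i = {x \<in> carrier G. \<forall>j\<in>I. j \<noteq> i \<longrightarrow> \<pi> j x = \<zero>}" if i: "i \<in> I" for i
  proof (intro equalityI subsetI)
    fix x assume "x \<in> {x \<in> carrier G. \<forall>j\<in>I. j \<noteq> i \<longrightarrow> \<pi> j x = \<zero>}"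
    then have x: "x \<in> carrier G" "\<And>j. j \<in> I \<Longrightarrow> j \<noteq> i \<Longrightarrow> \<pi> j x = \<zero>" by auto
    have "x = \<pi> i x"
    proof (rule eqI)
      show "\<pi> j x = \<pi> j (\<pi> i x)" if "j \<in> I" for j
        using x in_A[OF i x(1)] same[OF i] other[OF i that] that by (cases "j = i") auto
    qed (use x \<pi>_closed[OF i] in auto)
    then show "x \<in> A i" using in_A[OF i x(1)] by simp
  qed (use i A other in blast)+
  have A_sub: "additive_subgroup (A i) G" if i: "i \<in> I" for i
    unfolding A_kernel[OF i]
    by (rule additive_subgroupI'[OF G]) (auto simp: \<pi>_zero \<pi>_minus add)
  have F_closed: "f i \<in> carrier G" if "f \<in> ?F" for f i
    using that A by (cases "i \<in> I") (auto simp: direct_sum_families_def)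
  have F_fin: "finite {i. f i \<noteq> \<zero>}" if "f \<in> ?F" for f
    using that by (auto simp: direct_sum_families_def)
  have eval: "\<pi> j (?sum f) = f j" if f: "f \<in> ?F" and j: "j \<in> I" for f j
  proof -
    \<comment> \<open>The index \<open>j\<close> is added because \<open>f j\<close> may be zero, in
      which case \<open>j\<close> lies outside the support.\<close>
    let ?S = "insert j {i. f i \<noteq> \<zero>}"
    have fA: "f i \<in> A i" if "i \<in> I" for i using f that by (auto simp: direct_sum_families_def)
    have fI: "i \<in> I" if "i \<in> ?S" for i using f j that by (auto simp: direct_sum_families_def)
    have "?sum f = finsum G f ?S"
      by (rule finsum_support[OF G]) (use F_closed[OF f] F_fin[OF f] in auto)
    also have "\<pi> j \<dots> = (\<Oplus>i\<in>?S. \<pi> j (f i))"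
      by (rule additive_hom_finsum(2)[OF G G \<pi>_closed[OF j]])
        (use F_closed[OF f] add[OF j] in auto)
    also have "\<dots> = (\<Oplus>i\<in>?S. if j = i then f i else \<zero>)"
    proof (rule G.finsum_cong')
      show "\<pi> j (f i) = (if j = i then f i else \<zero>)" if "i \<in> ?S" for i
        using fA[OF fI[OF that]] same[OF j] other[OF fI[OF that] j] by auto
    qed (use F_closed[OF f] in auto)
    also have "\<dots> = f j"
      using F_closed[OF f] F_fin[OF f] by (intro G.add.finprod_singleton) auto
    finally show ?thesis .
  qed
  have sum_closed: "?sum f \<in> carrier G" if "f \<in> ?F" for f
    using F_closed[OF that] by (intro G.finsum_closed) auto
  have "bij_betw ?sum ?F (carrier G)"
    unfolding bij_betw_def
  proof (intro conjI inj_onI equalityI subsetI)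
    fix f g assume f: "f \<in> ?F" and g: "g \<in> ?F" and eq: "?sum f = ?sum g"
    show "f = g"
    proof
      show "f i = g i" for i
        using eval[OF f, of i] eval[OF g, of i] eq f g
        by (cases "i \<in> I") (auto simp: direct_sum_families_def)
    qed
  next
    fix x assume x: "x \<in> carrier G"
    define f where "f i = (if i \<in> I then \<pi> i x else \<zero>)" for i
    have "{i. f i \<noteq> \<zero>} = {i \<in> I. \<pi> i x \<noteq> \<zero>}" by (auto simp: f_def)
    then have f: "f \<in> ?F" using fin[OF x] in_A x by (auto simp: direct_sum_families_def f_def)
    have "x = ?sum f"
      by (rule eqI) (use x sum_closed[OF f] eval[OF f] in \<open>auto simp: f_def\<close>)
    then show "x \<in> ?sum ` ?F" using f by blast
  qed (use sum_closed in auto)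
  then show ?thesis using A_sub by (simp add: internal_direct_sum_def)
qed

section \<open>Components of an element and their calculus\<close>

context
  fixes G :: "('a, 'k) ring_scheme" (structure) and I :: "'i set" and A :: "'i \<Rightarrow> 'a set"
  assumes G: "abelian_group G" and dir: "internal_direct_sum G I A (carrier G)"
begin

interpretation G: abelian_group G by (rule G)

lemma summand_closed: "i \<in> I \<Longrightarrow> x \<in> A i \<Longrightarrow> x \<in> carrier G"
  using dir additive_subgroup.a_subset by (fastforce simp: internal_direct_sum_def)

lemma summand_subgroup: "i \<in> I \<Longrightarrow> additive_subgroup (A i) G"
  using dir by (simp add: internal_direct_sum_def)

lemma component_family: "x \<in> carrier G \<Longrightarrow> (\<lambda>i. component G I A i x) \<in> direct_sum_families G I A"
  and component_sum: "x \<in> carrier G \<Longrightarrow>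
    x = (\<Oplus>i\<in>{i. component G I A i x \<noteq> \<zero>}. component G I A i x)"
proof -
  assume "x \<in> carrier G"
  then have x: "x \<in> (\<lambda>f. finsum G f {i. f i \<noteq> \<zero>}) ` direct_sum_families G I A"
    using dir by (simp add: internal_direct_sum_def bij_betw_def)
  show "(\<lambda>i. component G I A i x) \<in> direct_sum_families G I A"
    unfolding component_def using inv_into_into[OF x] by simp
  show "x = (\<Oplus>i\<in>{i. component G I A i x \<noteq> \<zero>}. component G I A i x)"
    unfolding component_def using f_inv_into_f[OF x] by simp
qed

lemma component_eqI:
  assumes f: "f \<in> direct_sum_families G I A" and "x = finsum G f {i. f i \<noteq> \<zero>}"
  shows "component G I A i x = f i"
  unfolding component_def assms(2)
  by (subst inv_into_f_f) (use f dir in \<open>auto simp: internal_direct_sum_def bij_betw_def\<close>)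

lemma component_in: "x \<in> carrier G \<Longrightarrow> i \<in> I \<Longrightarrow> component G I A i x \<in> A i"
  and component_outside: "x \<in> carrier G \<Longrightarrow> i \<notin> I \<Longrightarrow> component G I A i x = \<zero>"
  and finite_component: "x \<in> carrier G \<Longrightarrow> finite {i. component G I A i x \<noteq> \<zero>}"
  using component_family by (auto simp: direct_sum_families_def)

lemma component_closed: "x \<in> carrier G \<Longrightarrow> component G I A i x \<in> carrier G"
  by (cases "i \<in> I") (auto simp: component_outside intro: component_in summand_closed)

lemma component_add:
  assumes x: "x \<in> carrier G" and y: "y \<in> carrier G"
  shows "component G I A i (x \<oplus> y) = component G I A i x \<oplus> component G I A i y"
proof -
  let ?h = "\<lambda>i. component G I A i x \<oplus> component G I A i y"
  let ?S = "{i. component G I A i x \<noteq> \<zero>} \<union> {i. component G I A i y \<noteq> \<zero>}"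
  have fin: "finite ?S" using x y finite_component by simp
  have hS: "{i. ?h i \<noteq> \<zero>} \<subseteq> ?S" by auto
  have h: "?h \<in> direct_sum_families G I A"
    using x y finite_subset[OF hS fin]
    by (auto simp: direct_sum_families_def component_outside component_in
        additive_subgroup.a_closed[OF summand_subgroup])
  have "finsum G ?h {i. ?h i \<noteq> \<zero>} = finsum G ?h ?S"
    by (rule finsum_support[OF G fin hS]) (use x y component_closed in auto)
  also have "\<dots> = (\<Oplus>i\<in>?S. component G I A i x) \<oplus> (\<Oplus>i\<in>?S. component G I A i y)"
    using x y component_closed by (intro G.finsum_addf) auto
  also have "(\<Oplus>i\<in>?S. component G I A i x) = x"
    using component_sum[OF x]
    by (subst finsum_support[OF G fin, symmetric]) (auto simp: component_closed x)
  also have "(\<Oplus>i\<in>?S. component G I A i y) = y"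
    using component_sum[OF y]
    by (subst finsum_support[OF G fin, symmetric]) (auto simp: component_closed y)
  finally show ?thesis by (intro component_eqI[OF h]) simp
qed

lemma component_homog:
  assumes "i \<in> I" "x \<in> A i"
  shows "component G I A j x = (if j = i then x else \<zero>)"
proof (rule component_eqI)
  let ?f = "\<lambda>j. if j = i then x else \<zero>"
  have S: "{j. ?f j \<noteq> \<zero>} \<subseteq> {i}" by auto
  show "?f \<in> direct_sum_families G I A"
    using assms finite_subset[OF S] summand_subgroup
    by (auto simp: direct_sum_families_def additive_subgroup.zero_closed)
  have "finsum G ?f {j. ?f j \<noteq> \<zero>} = finsum G ?f {i}"
    by (rule finsum_support[OF G _ S]) (use assms summand_closed in auto)
  then show "x = finsum G ?f {j. ?f j \<noteq> \<zero>}"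
    using assms summand_closed by (simp add: G.finsum_insert)
qed

text \<open>An element is the finite sum of its components, so membership in a subgroup can be
  tested on them. Claims about all elements are reduced to homogeneous ones in this way.\<close>

lemma component_induct:
  assumes "x \<in> carrier G" "additive_subgroup S G" "\<And>i. i \<in> I \<Longrightarrow> component G I A i x \<in> S"
  shows "x \<in> S"
proof -
  have "(\<Oplus>i\<in>{i. component G I A i x \<noteq> \<zero>}. component G I A i x) \<in> S"
    by (rule additive_subgroup_finsum[OF G assms(2)])
      (use assms component_outside in fastforce)
  with component_sum[OF assms(1)] show ?thesis by simp
qed

lemma component_zero: "component G I A i \<zero> = \<zero>"
  using component_add[of \<zero> \<zero> i] component_closed[of \<zero> i] by (metis G.add.r_cancel_one' G.l_zero G.zero_closed)

lemma component_sep: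
  assumes "x \<in> carrier G" "\<And>i. i \<in> I \<Longrightarrow> component G I A i x = \<zero>"
  shows "x = \<zero>"
proof -
  have "x \<in> {\<zero>}"
    by (rule component_induct[OF assms(1)]) (use assms(2) in \<open>auto intro: additive_subgroupI' simp: G\<close>)
  then show ?thesis by simp
qed

end

section \<open>Graded submodules and homomorphisms\<close>

text \<open>By uniqueness of decompositions, an internal decomposition of \<open>x\<close> in
  \<open>N\<close> is its decomposition in \<open>M\<close>. Closure under components is easier to
  check for images and for unions of chains than the direct sum condition.\<close>

lemma (in graded_right_module) gr_submodule_iff:
  "gr_submodule \<Gamma> R M N \<longleftrightarrow>
    additive_subgroup N M \<and> (\<forall>x\<in>N. \<forall>r\<in>carrier R. ract M x r \<in> N) \<and>
    (\<forall>x\<in>N. \<forall>\<sigma>\<in>carrier \<Gamma>. component M (carrier \<Gamma>) (homog M) \<sigma> x \<in> N)"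
proof (intro iffI conjI)
  assume N: "gr_submodule \<Gamma> R M N"
  show "\<forall>x\<in>N. \<forall>\<sigma>\<in>carrier \<Gamma>. component M (carrier \<Gamma>) (homog M) \<sigma> x \<in> N"
  proof (intro ballI)
    fix x \<sigma> assume x: "x \<in> N" and \<sigma>: "\<sigma> \<in> carrier \<Gamma>"
    obtain f where f: "f \<in> direct_sum_families M (carrier \<Gamma>) (\<lambda>\<gamma>. N \<inter> homog M \<gamma>)"
      "x = finsum M f {\<sigma>. f \<sigma> \<noteq> \<zero>\<^bsub>M\<^esub>}"
      using N x unfolding gr_submodule_def internal_direct_sum_def bij_betw_def by blast
    have "component M (carrier \<Gamma>) (homog M) \<sigma> x = f \<sigma>"
      by (rule component_eqI[OF M.abelian_group_axioms mod_grading _ f(2)])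
        (use f(1) in \<open>auto simp: direct_sum_families_def\<close>)
    then show "component M (carrier \<Gamma>) (homog M) \<sigma> x \<in> N"
      using f(1) \<sigma> by (simp add: direct_sum_families_def)
  qed
next
  assume N: "additive_subgroup N M \<and> (\<forall>x\<in>N. \<forall>r\<in>carrier R. ract M x r \<in> N) \<and>
    (\<forall>x\<in>N. \<forall>\<sigma>\<in>carrier \<Gamma>. component M (carrier \<Gamma>) (homog M) \<sigma> x \<in> N)"
  have NM: "x \<in> carrier M" if "x \<in> N" for x
    using N that additive_subgroup.a_subset by blast
  show "gr_submodule \<Gamma> R M N"
  proof (rule gr_submoduleI)
    fix S assume S: "additive_subgroup S M" and NS: "\<And>\<sigma>. \<sigma> \<in> carrier \<Gamma> \<Longrightarrow> N \<inter> homog M \<sigma> \<subseteq> S"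
    show "N \<subseteq> S"
    proof
      fix x assume x: "x \<in> N"
      show "x \<in> S"
        using N NS x component_in[OF M.abelian_group_axioms mod_grading NM[OF x]]
        by (intro component_induct[OF M.abelian_group_axioms mod_grading NM[OF x] S]) blast
    qed
  qed (use N in auto)
qed (auto simp: gr_submodule_def)

text \<open>Applying \<open>g\<close> to the homogeneous decomposition of \<open>x\<close> yields a
  homogeneous decomposition of \<open>g x\<close>, and decompositions in \<open>N\<close> are
  unique.\<close>

lemma gr_hom_component:
  assumes M: "graded_right_module \<Gamma> R M" and N: "graded_right_module \<Gamma> R N"
    and g: "g \<in> gr_hom \<Gamma> R M N" and x: "x \<in> carrier M"
  shows "component N (carrier \<Gamma>) (homog N) \<sigma> (g x) = g (component M (carrier \<Gamma>) (homog M) \<sigma> x)"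
proof -
  interpret M: graded_right_module \<Gamma> R M by fact
  interpret N: graded_right_module \<Gamma> R N by fact
  note MG = M.M.abelian_group_axioms and NG = N.M.abelian_group_axioms
  note Mc = M.M.abelian_group_axioms M.mod_grading
  let ?c = "\<lambda>\<sigma>. component M (carrier \<Gamma>) (homog M) \<sigma> x"
  have g0: "g \<zero>\<^bsub>M\<^esub> = \<zero>\<^bsub>N\<^esub>" by (rule additive_hom_zero[OF MG NG gr_homD(1,3)[OF g]])
  have supp: "{\<sigma>. g (?c \<sigma>) \<noteq> \<zero>\<^bsub>N\<^esub>} \<subseteq> {\<sigma>. ?c \<sigma> \<noteq> \<zero>\<^bsub>M\<^esub>}" using g0 by auto
  have fin: "finite {\<sigma>. ?c \<sigma> \<noteq> \<zero>\<^bsub>M\<^esub>}" by (rule finite_component[OF Mc x])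
  show ?thesis
  proof (rule component_eqI[OF NG N.mod_grading])
    show "(\<lambda>\<sigma>. g (?c \<sigma>)) \<in> direct_sum_families N (carrier \<Gamma>) (homog N)"
      using finite_subset[OF supp fin] gr_homD(5)[OF g] component_in[OF Mc x]
      by (auto simp: direct_sum_families_def component_outside[OF Mc x] g0)
    have "g x = g (finsum M ?c {\<sigma>. ?c \<sigma> \<noteq> \<zero>\<^bsub>M\<^esub>})"
      using component_sum[OF Mc x] by simp
    also have "\<dots> = finsum N (\<lambda>\<sigma>. g (?c \<sigma>)) {\<sigma>. ?c \<sigma> \<noteq> \<zero>\<^bsub>M\<^esub>}"
      by (rule additive_hom_finsum(2)[OF MG NG gr_homD(1,3)[OF g]])
        (auto simp: component_closed[OF Mc x])
    also have "\<dots> = finsum N (\<lambda>\<sigma>. g (?c \<sigma>)) {\<sigma>. g (?c \<sigma>) \<noteq> \<zero>\<^bsub>N\<^esub>}"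
      by (rule finsum_support[OF NG fin supp, symmetric])
        (use component_closed[OF Mc x] gr_homD(2)[OF g] in auto)
    finally show "g x = finsum N (\<lambda>\<sigma>. g (?c \<sigma>)) {\<sigma>. g (?c \<sigma>) \<noteq> \<zero>\<^bsub>N\<^esub>}" .
  qed
qed

lemma gr_submodule_image:
  assumes M: "graded_right_module \<Gamma> R M" and N: "graded_right_module \<Gamma> R N"
    and g: "g \<in> gr_hom \<Gamma> R M N"
  shows "gr_submodule \<Gamma> R N (g ` carrier M)"
proof -
  interpret M: graded_right_module \<Gamma> R M by fact
  interpret N: graded_right_module \<Gamma> R N by fact
  note MG = M.M.abelian_group_axioms and NG = N.M.abelian_group_axioms
  have "additive_subgroup (carrier M) M" by (rule additive_subgroupI'[OF MG]) auto
  then have "additive_subgroup (g ` carrier M) N"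
    by (rule image_additive_subgroup[OF MG NG _ gr_homD(1,3)[OF g]])
  moreover have "ract N (g x) r \<in> g ` carrier M" if "x \<in> carrier M" "r \<in> carrier R" for x r
    using that by (intro image_eqI[of _ _ "ract M x r"]) (simp_all add: gr_homD(4)[OF g] M.ract_closed)
  moreover have "component N (carrier \<Gamma>) (homog N) \<sigma> (g x) \<in> g ` carrier M" if "x \<in> carrier M" for x \<sigma>
    unfolding gr_hom_component[OF M N g that]
    using component_closed[OF MG M.mod_grading that] by blast
  ultimately show ?thesis unfolding N.gr_submodule_iff by blast
qed

text \<open>Zorn's lemma applies because each closure condition in \<open>gr_submodule_iff\<close>
  involves at most two elements of the submodule, and two elements of the union of a chain lie in a
  common member. Maximality is so far only among the submodules avoiding \<open>p\<close>.\<close>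

lemma (in graded_right_module) maximal_gr_submodule_avoiding:
  assumes K: "gr_submodule \<Gamma> R M K" and p: "p \<notin> K"
  obtains N where "gr_submodule \<Gamma> R M N" "K \<subseteq> N" "p \<notin> N"
    "\<And>N'. gr_submodule \<Gamma> R M N' \<Longrightarrow> N \<subseteq> N' \<Longrightarrow> p \<notin> N' \<Longrightarrow> N' = N"
proof -
  let ?A = "{N. gr_submodule \<Gamma> R M N \<and> K \<subseteq> N \<and> p \<notin> N}"
  have "\<exists>N\<in>?A. \<forall>X\<in>?A. N \<subseteq> X \<longrightarrow> X = N"
  proof (rule subset_Zorn_nonempty)
    fix C assume C: "C \<noteq> {}" "subset.chain ?A C"
    have sub: "gr_submodule \<Gamma> R M N" "K \<subseteq> N" "p \<notin> N" if "N \<in> C" for N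
      using C(2) that by (auto simp: subset.chain_def)
    have "additive_subgroup (\<Union>C) M"
    proof (rule additive_subgroupI'[OF M.abelian_group_axioms])
      show "\<Union>C \<subseteq> carrier M" "\<zero>\<^bsub>M\<^esub> \<in> \<Union>C"
        using sub(1) C(1) additive_subgroup.a_subset additive_subgroup.zero_closed
        unfolding gr_submodule_def by blast+
      show "\<ominus>\<^bsub>M\<^esub> x \<in> \<Union>C" if x: "x \<in> \<Union>C" for x
      proof -
        obtain N where "N \<in> C" "x \<in> N" using x by blast
        then show ?thesis
          using sub(1) additive_subgroup.a_inv_closed[of N M x]
          by (auto simp: gr_submodule_def)
      qed
    next
      fix x y assume "x \<in> \<Union>C" "y \<in> \<Union>C"
      then obtain N where "N \<in> C" "x \<in> N" "y \<in> N"
        using C(2) unfolding subset.chain_def by blast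
      then show "x \<oplus>\<^bsub>M\<^esub> y \<in> \<Union>C"
        using sub(1) additive_subgroup.a_closed[of N M x y] by (auto simp: gr_submodule_def)
    qed
    moreover have "ract M x r \<in> \<Union>C" if "x \<in> \<Union>C" "r \<in> carrier R" for x r
      using that sub(1) unfolding gr_submodule_iff by (meson UnionE UnionI)
    moreover have "component M (carrier \<Gamma>) (homog M) \<sigma> x \<in> \<Union>C" if "x \<in> \<Union>C" "\<sigma> \<in> carrier \<Gamma>" for x \<sigma>
      using that sub(1) unfolding gr_submodule_iff by (meson UnionE UnionI)
    ultimately have "gr_submodule \<Gamma> R M (\<Union>C)" by (simp add: gr_submodule_iff)
    then show "\<Union>C \<in> ?A" using sub C(1) by blast
  qed (use K p in blast)
  then obtain N where N: "N \<in> ?A" "\<forall>X\<in>?A. N \<subseteq> X \<longrightarrow> X = N" by (rule bexE)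
  show thesis
  proof (rule that[of N])
    show "N' = N" if "gr_submodule \<Gamma> R M N'" "N \<subseteq> N'" "p \<notin> N'" for N'
      using bspec[OF N(2), of N'] N(1) that by auto
  qed (use N(1) in auto)
qed

section \<open>Shifted free modules of rank one\<close>

context groupoid
begin

text \<open>This is the arrow \<sigma>^{-1} \<tau>, meaningful when \<open>\<sigma>\<close> and
  \<open>\<tau>\<close> have the same target. It is chosen by its defining equation, since inverses
  are only asserted to exist.\<close>

definition ldiv :: "'a \<Rightarrow> 'a \<Rightarrow> 'a" where
  "ldiv \<sigma> \<tau> = (SOME \<rho>. \<rho> \<in> carrier \<Gamma> \<and> tgt \<Gamma> \<rho> = src \<Gamma> \<sigma> \<and> cmp \<Gamma> \<sigma> \<rho> = \<tau>)"

lemma ldiv: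
  assumes "\<sigma> \<in> carrier \<Gamma>" "\<tau> \<in> carrier \<Gamma>" "tgt \<Gamma> \<sigma> = tgt \<Gamma> \<tau>"
  shows "ldiv \<sigma> \<tau> \<in> carrier \<Gamma>" "tgt \<Gamma> (ldiv \<sigma> \<tau>) = src \<Gamma> \<sigma>" "cmp \<Gamma> \<sigma> (ldiv \<sigma> \<tau>) = \<tau>"
proof -
  obtain \<delta> where \<delta>: "\<delta> \<in> carrier \<Gamma>" "src \<Gamma> \<delta> = tgt \<Gamma> \<sigma>" "tgt \<Gamma> \<delta> = src \<Gamma> \<sigma>" "cmp \<Gamma> \<sigma> \<delta> = tgt \<Gamma> \<sigma>"
    using invertible[OF assms(1)] by blast
  have "cmp \<Gamma> \<sigma> (cmp \<Gamma> \<delta> \<tau>) = \<tau>"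
    using cmp_assoc[of \<sigma> \<delta> \<tau>] \<delta> assms tgt_cmp_id by simp
  then have "\<exists>\<rho>. \<rho> \<in> carrier \<Gamma> \<and> tgt \<Gamma> \<rho> = src \<Gamma> \<sigma> \<and> cmp \<Gamma> \<sigma> \<rho> = \<tau>"
    using \<delta> assms cmp_closed[of \<delta> \<tau>] tgt_cmp[of \<delta> \<tau>] by auto
  from someI_ex[OF this]
  show "ldiv \<sigma> \<tau> \<in> carrier \<Gamma>" "tgt \<Gamma> (ldiv \<sigma> \<tau>) = src \<Gamma> \<sigma>" "cmp \<Gamma> \<sigma> (ldiv \<sigma> \<tau>) = \<tau>"
    unfolding ldiv_def by blast+
qed

text \<open>Composing with an inverse \<open>\<delta>\<close> cancels \<open>\<sigma>\<close> on the
  left, so the solution selected by \<open>ldiv\<close> is the only one.\<close>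

lemma ldiv_cmp:
  assumes "\<sigma> \<in> carrier \<Gamma>" "\<rho> \<in> carrier \<Gamma>" "src \<Gamma> \<sigma> = tgt \<Gamma> \<rho>"
  shows "ldiv \<sigma> (cmp \<Gamma> \<sigma> \<rho>) = \<rho>"
proof -
  obtain \<delta> where \<delta>: "\<delta> \<in> carrier \<Gamma>" "src \<Gamma> \<delta> = tgt \<Gamma> \<sigma>" "tgt \<Gamma> \<delta> = src \<Gamma> \<sigma>" "cmp \<Gamma> \<delta> \<sigma> = src \<Gamma> \<sigma>"
    using invertible[OF assms(1)] by blast
  have cancel: "cmp \<Gamma> \<delta> (cmp \<Gamma> \<sigma> \<rho>') = \<rho>'" if "\<rho>' \<in> carrier \<Gamma>" "src \<Gamma> \<sigma> = tgt \<Gamma> \<rho>'" for \<rho>'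
    using cmp_assoc[of \<delta> \<sigma> \<rho>'] \<delta> assms that tgt_cmp_id[of \<rho>'] by simp
  have "cmp \<Gamma> \<sigma> \<rho> \<in> carrier \<Gamma>" "tgt \<Gamma> \<sigma> = tgt \<Gamma> (cmp \<Gamma> \<sigma> \<rho>)"
    using assms cmp_closed tgt_cmp by auto
  note l = ldiv[OF assms(1) this]
  show ?thesis using cancel[OF l(1)] cancel[OF assms(2,3)] l(2,3) by simp
qed

lemma src_ldiv:
  assumes "\<sigma> \<in> carrier \<Gamma>" "\<tau> \<in> carrier \<Gamma>" "tgt \<Gamma> \<sigma> = tgt \<Gamma> \<tau>"
  shows "src \<Gamma> (ldiv \<sigma> \<tau>) = src \<Gamma> \<tau>"
  using src_cmp[OF assms(1) ldiv(1)[OF assms]] ldiv[OF assms] by simp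

text \<open>Associativity in the form (\<sigma>^{-1} \<tau>) \<rho> = \<sigma>^{-1} (\<tau> \<rho>);
  it makes the shifted grading compatible with the action of \<open>R\<close>.\<close>

lemma cmp_ldiv:
  assumes "\<sigma> \<in> carrier \<Gamma>" "\<tau> \<in> carrier \<Gamma>" "tgt \<Gamma> \<sigma> = tgt \<Gamma> \<tau>" "\<rho> \<in> carrier \<Gamma>" "src \<Gamma> \<tau> = tgt \<Gamma> \<rho>"
  shows "cmp \<Gamma> (ldiv \<sigma> \<tau>) \<rho> = ldiv \<sigma> (cmp \<Gamma> \<tau> \<rho>)"
proof -
  note l = ldiv[OF assms(1-3)] src_ldiv[OF assms(1-3)]
  have "ldiv \<sigma> (cmp \<Gamma> \<sigma> (cmp \<Gamma> (ldiv \<sigma> \<tau>) \<rho>)) = cmp \<Gamma> (ldiv \<sigma> \<tau>) \<rho>"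
    using l assms cmp_closed tgt_cmp by (intro ldiv_cmp) auto
  then show ?thesis using cmp_assoc[of \<sigma> "ldiv \<sigma> \<tau>" \<rho>] l assms by simp
qed

end

section \<open>The modules 1_e R with shifted degrees\<close>

context graded_ring
begin

lemma is_identity_obj_one:
  assumes "e \<in> identities \<Gamma>"
  shows "is_identity_of R (homog R e) (obj_one R e)"
proof -
  obtain u where u: "is_identity_of R (homog R e) u" using ex_identity[OF assms] by blast
  show ?thesis
    unfolding obj_one_def
  proof (rule theI[where P = "is_identity_of R (homog R e)", OF u])
    show "v = u" if "is_identity_of R (homog R e) v" for v
      using u that unfolding is_identity_of_def by metis
  qed
qed

lemma homog_closed: "\<rho> \<in> carrier \<Gamma> \<Longrightarrow> r \<in> homog R \<rho> \<Longrightarrow> r \<in> carrier R"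
  by (rule summand_closed[OF abelian_group_axioms ring_grading])

lemma obj_one_homog: "\<sigma> \<in> carrier \<Gamma> \<Longrightarrow> obj_one R (src \<Gamma> \<sigma>) \<in> homog R (src \<Gamma> \<sigma>)"
  using is_identity_obj_one[of "src \<Gamma> \<sigma>"] by (auto simp: is_identity_of_def identities_def)

lemma obj_one_closed: "\<sigma> \<in> carrier \<Gamma> \<Longrightarrow> obj_one R (src \<Gamma> \<sigma>) \<in> carrier R"
  using obj_one_homog homog_closed src_closed by blast

lemma mult_zero_right: "x \<in> carrier R \<Longrightarrow> x \<otimes>\<^bsub>R\<^esub> \<zero>\<^bsub>R\<^esub> = \<zero>\<^bsub>R\<^esub>"
  by (rule additive_hom_zero[of R R "\<lambda>r. x \<otimes>\<^bsub>R\<^esub> r"])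
    (auto intro: m_closed r_distr abelian_group_axioms)

lemma mult_zero_left: "x \<in> carrier R \<Longrightarrow> \<zero>\<^bsub>R\<^esub> \<otimes>\<^bsub>R\<^esub> x = \<zero>\<^bsub>R\<^esub>"
  by (rule additive_hom_zero[of R R "\<lambda>r. r \<otimes>\<^bsub>R\<^esub> x"])
    (auto intro: m_closed l_distr abelian_group_axioms)

text \<open>Left multiplication by 1_e, where e is the source of \<open>\<sigma>\<close>, fixes the
  homogeneous elements with target e and kills the others. The \<open>r\<close> satisfying the claim
  form a subgroup, so checking its components suffices.\<close>

lemma component_obj_one_mult:
  assumes \<sigma>: "\<sigma> \<in> carrier \<Gamma>" and r: "r \<in> carrier R" and \<rho>: "\<rho> \<in> carrier \<Gamma>" "tgt \<Gamma> \<rho> \<noteq> src \<Gamma> \<sigma>"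
  shows "component R (carrier \<Gamma>) (homog R) \<rho> (obj_one R (src \<Gamma> \<sigma>) \<otimes>\<^bsub>R\<^esub> r) = \<zero>\<^bsub>R\<^esub>"
proof -
  note RG = abelian_group_axioms and Rc = abelian_group_axioms ring_grading
  let ?e = "obj_one R (src \<Gamma> \<sigma>)" and ?c = "component R (carrier \<Gamma>) (homog R)"
  have u: "(\<lambda>r. ?c \<rho> (?e \<otimes>\<^bsub>R\<^esub> r)) \<in> carrier R \<rightarrow> carrier R"
    using component_closed[OF Rc] m_closed obj_one_closed[OF \<sigma>] by auto
  have "additive_subgroup {\<zero>\<^bsub>R\<^esub>} R" by (rule additive_subgroupI'[OF RG]) auto
  from preimage_additive_subgroup[OF RG RG this u]
  have S: "additive_subgroup {r \<in> carrier R. ?c \<rho> (?e \<otimes>\<^bsub>R\<^esub> r) \<in> {\<zero>\<^bsub>R\<^esub>}} R"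
    using component_add[OF Rc] m_closed obj_one_closed[OF \<sigma>] r_distr by simp
  have "?c \<rho> (?e \<otimes>\<^bsub>R\<^esub> ?c \<tau> r) = \<zero>\<^bsub>R\<^esub>" if \<tau>: "\<tau> \<in> carrier \<Gamma>" for \<tau>
  proof (cases "src \<Gamma> \<sigma> = tgt \<Gamma> \<tau>")
    case True
    then show ?thesis
      using obj_one_left[OF \<tau> component_in[OF Rc r \<tau>]] \<rho>
        component_homog[OF Rc \<tau> component_in[OF Rc r \<tau>], of \<rho>] by auto
  next
    case False
    then have "?e \<otimes>\<^bsub>R\<^esub> ?c \<tau> r = \<zero>\<^bsub>R\<^esub>"
      using ring_homog_mult_zero[OF src_closed[OF \<sigma>] \<tau> _ obj_one_homog[OF \<sigma>] component_in[OF Rc r \<tau>]]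
        src_src[OF \<sigma>] by simp
    then show ?thesis by (simp add: component_zero[OF Rc])
  qed
  then have "r \<in> {r \<in> carrier R. ?c \<rho> (?e \<otimes>\<^bsub>R\<^esub> r) \<in> {\<zero>\<^bsub>R\<^esub>}}"
    by (intro component_induct[OF Rc r S]) (auto simp: component_closed[OF Rc r])
  then show ?thesis by simp
qed

text \<open>This is the right module 1_e R for e the source of \<open>\<sigma>\<close>, regraded so
  that its generator 1_e has degree \<open>\<sigma>\<close>. Since 1_e is idempotent, 1_e R is the
  set of elements fixed by 1_e. Degrees whose target differs from that of \<open>\<sigma>\<close>
  are not of the form \<sigma> \<rho> and carry only zero.\<close>

definition shifted :: "'g \<Rightarrow> ('r, 'g, 'r) graded_rmod" where
  "shifted \<sigma> = \<lparr>carrier = {r \<in> carrier R. obj_one R (src \<Gamma> \<sigma>) \<otimes>\<^bsub>R\<^esub> r = r},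
    mult = undefined, one = undefined, zero = \<zero>\<^bsub>R\<^esub>, add = add R,
    homog = (\<lambda>\<tau>. if tgt \<Gamma> \<sigma> = tgt \<Gamma> \<tau> then homog R (ldiv \<sigma> \<tau>) else {\<zero>\<^bsub>R\<^esub>}), ract = mult R\<rparr>"

lemma shifted_simps [simp]:
  "r \<in> carrier (shifted \<sigma>) \<longleftrightarrow> r \<in> carrier R \<and> obj_one R (src \<Gamma> \<sigma>) \<otimes>\<^bsub>R\<^esub> r = r"
  "\<zero>\<^bsub>shifted \<sigma>\<^esub> = \<zero>\<^bsub>R\<^esub>" "x \<oplus>\<^bsub>shifted \<sigma>\<^esub> y = x \<oplus>\<^bsub>R\<^esub> y" "ract (shifted \<sigma>) = mult R"
  "homog (shifted \<sigma>) \<tau> = (if tgt \<Gamma> \<sigma> = tgt \<Gamma> \<tau> then homog R (ldiv \<sigma> \<tau>) else {\<zero>\<^bsub>R\<^esub>})"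
  by (auto simp: shifted_def)

lemma graded_right_module_shifted:
  assumes \<sigma>: "\<sigma> \<in> carrier \<Gamma>"
  shows "graded_right_module \<Gamma> R (shifted \<sigma>)"
proof -
  note Rc = abelian_group_axioms ring_grading
  let ?e = "obj_one R (src \<Gamma> \<sigma>)" and ?c = "component R (carrier \<Gamma>) (homog R)"
  have e: "?e \<in> carrier R" by (rule obj_one_closed[OF \<sigma>])
  have SG: "abelian_group (shifted \<sigma>)"
  proof (rule abelian_groupI)
    fix x assume "x \<in> carrier (shifted \<sigma>)"
    then have x: "x \<in> carrier R" "?e \<otimes>\<^bsub>R\<^esub> x = x" by auto
    have "?e \<otimes>\<^bsub>R\<^esub> (\<ominus>\<^bsub>R\<^esub> x) \<oplus>\<^bsub>R\<^esub> x = \<zero>\<^bsub>R\<^esub>"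
      using r_distr[of "\<ominus>\<^bsub>R\<^esub> x" x ?e] x e by (simp add: l_neg mult_zero_right)
    then have "?e \<otimes>\<^bsub>R\<^esub> (\<ominus>\<^bsub>R\<^esub> x) = \<ominus>\<^bsub>R\<^esub> x"
      using x e by (intro minus_equality[symmetric]) (auto intro: m_closed)
    then show "\<exists>y\<in>carrier (shifted \<sigma>). y \<oplus>\<^bsub>shifted \<sigma>\<^esub> x = \<zero>\<^bsub>shifted \<sigma>\<^esub>"
      using x by (intro bexI[of _ "\<ominus>\<^bsub>R\<^esub> x"]) (auto simp: l_neg)
  qed (auto simp: e r_distr a_ac mult_zero_right)
  have homog_sub: "homog R \<rho> \<subseteq> carrier (shifted \<sigma>)" if "\<rho> \<in> carrier \<Gamma>" "tgt \<Gamma> \<rho> = src \<Gamma> \<sigma>" for \<rho>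
    using that obj_one_left[of \<rho>] homog_closed by auto
  have off: "?c \<rho> r = \<zero>\<^bsub>R\<^esub>" if "r \<in> carrier (shifted \<sigma>)" "\<rho> \<in> carrier \<Gamma>" "tgt \<Gamma> \<rho> \<noteq> src \<Gamma> \<sigma>" for r \<rho>
    using component_obj_one_mult[OF \<sigma>, of r \<rho>] that by simp
  \<comment> \<open>The projection to degree \<open>\<tau>\<close> is the ring component of degree
    \<sigma>^{-1} \<tau>.\<close>
  define \<pi> where "\<pi> \<tau> r = (if tgt \<Gamma> \<sigma> = tgt \<Gamma> \<tau> then ?c (ldiv \<sigma> \<tau>) r else \<zero>\<^bsub>R\<^esub>)" for \<tau> r
  have "internal_direct_sum (shifted \<sigma>) (carrier \<Gamma>) (homog (shifted \<sigma>)) (carrier (shifted \<sigma>))"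
  proof (rule internal_direct_sumI[OF SG, where \<pi> = \<pi>])
    fix \<tau> assume \<tau>: "\<tau> \<in> carrier \<Gamma>"
    show "homog (shifted \<sigma>) \<tau> \<subseteq> carrier (shifted \<sigma>)"
      using homog_sub[of "ldiv \<sigma> \<tau>"] ldiv[OF \<sigma> \<tau>] e by (auto simp: mult_zero_right)
    fix x assume x: "x \<in> carrier (shifted \<sigma>)"
    then show "\<pi> \<tau> x \<in> homog (shifted \<sigma>) \<tau>"
      using ldiv[OF \<sigma> \<tau>] by (auto simp: \<pi>_def intro: component_in[OF Rc])
    show "\<pi> \<tau> (x \<oplus>\<^bsub>shifted \<sigma>\<^esub> y) = \<pi> \<tau> x \<oplus>\<^bsub>shifted \<sigma>\<^esub> \<pi> \<tau> y" if "y \<in> carrier (shifted \<sigma>)" for y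
      using x that by (auto simp: \<pi>_def component_add[OF Rc])
  next
    fix \<tau> x assume \<tau>: "\<tau> \<in> carrier \<Gamma>" and x: "x \<in> homog (shifted \<sigma>) \<tau>"
    then show "\<pi> \<tau> x = x"
      using ldiv[OF \<sigma> \<tau>] by (auto simp: \<pi>_def component_homog[OF Rc])
    show "\<pi> \<tau>' x = \<zero>\<^bsub>shifted \<sigma>\<^esub>" if "\<tau>' \<in> carrier \<Gamma>" "\<tau> \<noteq> \<tau>'" for \<tau>'
      using x ldiv[OF \<sigma> \<tau>] ldiv[OF \<sigma> that(1)] that
      by (auto simp: \<pi>_def component_homog[OF Rc] component_zero[OF Rc] split: if_splits)
  next
    fix x assume x: "x \<in> carrier (shifted \<sigma>)"
    \<comment> \<open>The degree \<open>\<tau>\<close> is recovered from \<sigma>^{-1} \<tau> by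
      composing with \<open>\<sigma>\<close>, so the new support is covered by an image of the
      finite support of \<open>x\<close> in \<open>R\<close>.\<close>
    have "{\<tau> \<in> carrier \<Gamma>. \<pi> \<tau> x \<noteq> \<zero>\<^bsub>R\<^esub>} \<subseteq> cmp \<Gamma> \<sigma> ` {\<rho>. ?c \<rho> x \<noteq> \<zero>\<^bsub>R\<^esub>}"
    proof
      fix \<tau> assume "\<tau> \<in> {\<tau> \<in> carrier \<Gamma>. \<pi> \<tau> x \<noteq> \<zero>\<^bsub>R\<^esub>}"
      then have "?c (ldiv \<sigma> \<tau>) x \<noteq> \<zero>\<^bsub>R\<^esub>" "\<tau> = cmp \<Gamma> \<sigma> (ldiv \<sigma> \<tau>)"
        using ldiv[OF \<sigma>, of \<tau>] by (auto simp: \<pi>_def split: if_splits)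
      then show "\<tau> \<in> cmp \<Gamma> \<sigma> ` {\<rho>. ?c \<rho> x \<noteq> \<zero>\<^bsub>R\<^esub>}" by blast
    qed
    then show "finite {\<tau> \<in> carrier \<Gamma>. \<pi> \<tau> x \<noteq> \<zero>\<^bsub>shifted \<sigma>\<^esub>}"
      using finite_component[OF Rc, of x] x by (auto intro: finite_subset)
    assume \<pi>0: "\<And>\<tau>. \<tau> \<in> carrier \<Gamma> \<Longrightarrow> \<pi> \<tau> x = \<zero>\<^bsub>shifted \<sigma>\<^esub>"
    \<comment> \<open>A component whose degree \<open>\<rho>\<close> is composable with
      \<open>\<sigma>\<close> is the projection to degree
      \<open>cmp \<Gamma> \<sigma> \<rho>\<close>; every other component vanishes by
      \<open>off\<close>.\<close>
    have "?c \<rho> x = \<zero>\<^bsub>R\<^esub>" if \<rho>: "\<rho> \<in> carrier \<Gamma>" for \<rho>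
    proof (cases "src \<Gamma> \<sigma> = tgt \<Gamma> \<rho>")
      case True
      then show ?thesis
        using \<pi>0[of "cmp \<Gamma> \<sigma> \<rho>"] \<sigma> \<rho> by (simp add: \<pi>_def cmp_closed tgt_cmp ldiv_cmp)
    qed (use off[OF x \<rho>] in simp)
    then show "x = \<zero>\<^bsub>shifted \<sigma>\<^esub>" using component_sep[OF Rc, of x] x by simp
  qed
  moreover have "r \<otimes>\<^bsub>R\<^esub> s \<in> homog (shifted \<sigma>) (cmp \<Gamma> \<tau> \<rho>)"
    if "\<tau> \<in> carrier \<Gamma>" "\<rho> \<in> carrier \<Gamma>" "src \<Gamma> \<tau> = tgt \<Gamma> \<rho>" "r \<in> homog (shifted \<sigma>) \<tau>" "s \<in> homog R \<rho>" for \<tau> \<rho> r s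
    using that ring_homog_mult[of "ldiv \<sigma> \<tau>" \<rho> r s] \<sigma> ldiv[OF \<sigma>, of \<tau>] src_ldiv[OF \<sigma>, of \<tau>] homog_closed
    by (auto simp: tgt_cmp cmp_ldiv mult_zero_left split: if_splits)
  moreover have "r \<otimes>\<^bsub>R\<^esub> s = \<zero>\<^bsub>R\<^esub>"
    if "\<tau> \<in> carrier \<Gamma>" "\<rho> \<in> carrier \<Gamma>" "src \<Gamma> \<tau> \<noteq> tgt \<Gamma> \<rho>" "r \<in> homog (shifted \<sigma>) \<tau>" "s \<in> homog R \<rho>" for \<tau> \<rho> r s
    using that ring_homog_mult_zero[of "ldiv \<sigma> \<tau>" \<rho> r s] ldiv[OF \<sigma>, of \<tau>] src_ldiv[OF \<sigma>, of \<tau>] homog_closed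
    by (auto simp: mult_zero_left split: if_splits)
  moreover have "r \<otimes>\<^bsub>R\<^esub> obj_one R (src \<Gamma> \<tau>) = r"
    if "\<tau> \<in> carrier \<Gamma>" "r \<in> homog (shifted \<sigma>) \<tau>" for \<tau> r
    using that obj_one_right[of "ldiv \<sigma> \<tau>" r] ldiv[OF \<sigma>, of \<tau>] src_ldiv[OF \<sigma>, of \<tau>] obj_one_closed
    by (auto simp: mult_zero_left split: if_splits)
  moreover have "?e \<otimes>\<^bsub>R\<^esub> (x \<otimes>\<^bsub>R\<^esub> r) = x \<otimes>\<^bsub>R\<^esub> r"
    if "x \<in> carrier R" "?e \<otimes>\<^bsub>R\<^esub> x = x" "r \<in> carrier R" for x r
    using that m_assoc[of ?e x r] e by simp
  ultimately show ?thesis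
    by (intro graded_right_module.intro graded_right_module_axioms.intro graded_ring_axioms SG)
      (simp_all only: shifted_simps, simp_all add: m_closed l_distr r_distr m_assoc)
qed

end

section \<open>Modules without gr-maximal submodules\<close>

context graded_right_module
begin

text \<open>The shift is made for this map: an element r of shifted degree \<open>\<tau>\<close> has
  degree \<sigma>^{-1} \<tau> in \<open>R\<close>, so p r has degree \<sigma> \<sigma>^{-1} \<tau> =
  \<tau>. These maps cover a module by modules of the form 1_e R.\<close>

lemma ract_shifted_gr_hom:
  assumes \<sigma>: "\<sigma> \<in> carrier \<Gamma>" and p: "p \<in> homog M \<sigma>"
  shows "ract M p \<in> gr_hom \<Gamma> R (shifted \<sigma>) M"
proof -
  have pM: "p \<in> carrier M" using homog_carrier[OF \<sigma> p] .
  have "ract M p r \<in> homog M \<tau>" if \<tau>: "\<tau> \<in> carrier \<Gamma>" and r: "r \<in> homog (shifted \<sigma>) \<tau>" for \<tau> r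
  proof (cases "tgt \<Gamma> \<sigma> = tgt \<Gamma> \<tau>")
    case True
    note l = ldiv[OF \<sigma> \<tau> True]
    show ?thesis using homog_ract[OF \<sigma> l(1) _ p, of r] l r True by simp
  next
    case False
    then show ?thesis
      using r pM additive_subgroup.zero_closed[OF homog_subgroup[OF \<tau>]] by (simp add: ract_zero_right)
  qed
  then show ?thesis
    using pM by (auto simp: gr_hom_def ract_closed ract_add_right ract_assoc simp del: shifted_simps(5))
qed

end

section \<open>Quasi-inverses for the product of a module defined by a functional\<close>

locale graded_functional = graded_right_module +
  fixes \<sigma> f
  assumes \<sigma>: "\<sigma> \<in> carrier \<Gamma>" and f: "f \<in> gr_hom \<Gamma> R M (shifted \<sigma>)"
begin

lemma f_closed: "x \<in> carrier M \<Longrightarrow> f x \<in> carrier R"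
  and f_add: "x \<in> carrier M \<Longrightarrow> y \<in> carrier M \<Longrightarrow> f (x \<oplus>\<^bsub>M\<^esub> y) = f x \<oplus>\<^bsub>R\<^esub> f y"
  and f_ract: "x \<in> carrier M \<Longrightarrow> r \<in> carrier R \<Longrightarrow> f (ract M x r) = f x \<otimes>\<^bsub>R\<^esub> r"
  using gr_homD(2-4)[OF f] by auto

text \<open>Linearity of \<open>f\<close> gives p f(q) f(x) = p f(q f(x)), so the product is
  associative and \<open>M\<close> becomes a ring without a unit. An element \<open>p\<close> stands
  for the operator 1 + p acting by \<open>x \<oplus> p \<star> x\<close>, and its quasi-inverse for
  the inverse operator.\<close>

definition star :: "'c \<Rightarrow> 'c \<Rightarrow> 'c" (infixl "\<star>" 70) where
  "p \<star> x = ract M p (f x)"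

lemma star_closed: "p \<in> carrier M \<Longrightarrow> x \<in> carrier M \<Longrightarrow> p \<star> x \<in> carrier M"
  and star_add_left: "p \<in> carrier M \<Longrightarrow> q \<in> carrier M \<Longrightarrow> x \<in> carrier M \<Longrightarrow>
    (p \<oplus>\<^bsub>M\<^esub> q) \<star> x = p \<star> x \<oplus>\<^bsub>M\<^esub> q \<star> x"
  and star_add_right: "p \<in> carrier M \<Longrightarrow> x \<in> carrier M \<Longrightarrow> y \<in> carrier M \<Longrightarrow>
    p \<star> (x \<oplus>\<^bsub>M\<^esub> y) = p \<star> x \<oplus>\<^bsub>M\<^esub> p \<star> y"
  and star_assoc: "p \<in> carrier M \<Longrightarrow> q \<in> carrier M \<Longrightarrow> x \<in> carrier M \<Longrightarrow> p \<star> q \<star> x = p \<star> (q \<star> x)"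
  and star_ract: "p \<in> carrier M \<Longrightarrow> x \<in> carrier M \<Longrightarrow> r \<in> carrier R \<Longrightarrow>
    p \<star> ract M x r = ract M (p \<star> x) r"
  by (simp_all add: star_def f_closed f_add f_ract ract_closed ract_add_left ract_add_right ract_assoc)

text \<open>Left multiplication by \<open>p\<close> factors through \<open>shifted \<sigma>\<close>
  as \<open>f\<close> followed by \<open>ract M p\<close>, and both maps preserve degrees.\<close>

lemma star_homog:
  assumes "p \<in> homog M \<sigma>" "\<tau> \<in> carrier \<Gamma>" "x \<in> homog M \<tau>"
  shows "p \<star> x \<in> homog M \<tau>"
  unfolding star_def
  using gr_homD(5)[OF ract_shifted_gr_hom[OF \<sigma> assms(1)] assms(2) gr_homD(5)[OF f assms(2,3)]] .

lemma star_zero: "x \<in> carrier M \<Longrightarrow> x \<star> \<zero>\<^bsub>M\<^esub> = \<zero>\<^bsub>M\<^esub>" "x \<in> carrier M \<Longrightarrow> \<zero>\<^bsub>M\<^esub> \<star> x = \<zero>\<^bsub>M\<^esub>"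
proof -
  show "x \<star> \<zero>\<^bsub>M\<^esub> = \<zero>\<^bsub>M\<^esub>" if "x \<in> carrier M"
    by (rule additive_hom_zero[of M M "\<lambda>y. x \<star> y"])
      (use that in \<open>auto intro: star_closed star_add_right M.abelian_group_axioms\<close>)
  show "\<zero>\<^bsub>M\<^esub> \<star> x = \<zero>\<^bsub>M\<^esub>" if "x \<in> carrier M"
    using that by (simp add: star_def ract_zero_left f_closed)
qed

lemma one_plus_star_gr_hom:
  assumes p: "p \<in> homog M \<sigma>"
  shows "(\<lambda>x. x \<oplus>\<^bsub>M\<^esub> p \<star> x) \<in> gr_hom \<Gamma> R M M"
  using homog_carrier[OF \<sigma> p] star_homog[OF p] additive_subgroup.a_closed[OF homog_subgroup]
  by (auto simp: gr_hom_def star_closed star_add_right star_ract ract_closed ract_add_left M.a_ac)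

text \<open>If \<open>- p\<close> were not of the form \<open>x + p * x\<close>, then a graded submodule containing all
  \<open>x + p * x\<close> and maximal with respect to avoiding \<open>p\<close> would be gr-maximal, since adding \<open>p\<close> to it
  yields all of \<open>M\<close>.\<close>

lemma ex_right_quasi_inverse:
  assumes no_max: "\<nexists>N. gr_maximal \<Gamma> R M N" and p: "p \<in> homog M \<sigma>"
  shows "\<exists>y\<in>homog M \<sigma>. p \<oplus>\<^bsub>M\<^esub> y \<oplus>\<^bsub>M\<^esub> p \<star> y = \<zero>\<^bsub>M\<^esub>"
proof -
  let ?g = "\<lambda>x. x \<oplus>\<^bsub>M\<^esub> p \<star> x" and ?c = "component M (carrier \<Gamma>) (homog M)"
  note Mm = graded_right_module_axioms and g = one_plus_star_gr_hom[OF p]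
    and Mc = M.abelian_group_axioms mod_grading
  define K where "K = ?g ` carrier M"
  have K: "gr_submodule \<Gamma> R M K"
    unfolding K_def by (rule gr_submodule_image[OF Mm Mm g])
  have pM: "p \<in> carrier M" by (rule homog_carrier[OF \<sigma> p])
  have "p \<in> K"
  proof (rule ccontr)
    assume "p \<notin> K"
    from maximal_gr_submodule_avoiding[OF K this] obtain N where N: "gr_submodule \<Gamma> R M N" "K \<subseteq> N" "p \<notin> N"
      and N_max: "\<And>N'. gr_submodule \<Gamma> R M N' \<Longrightarrow> N \<subseteq> N' \<Longrightarrow> p \<notin> N' \<Longrightarrow> N' = N"
      by metis
    have "gr_maximal \<Gamma> R M N"
      unfolding gr_maximal_def
    proof (intro conjI allI impI)
      show "N \<noteq> carrier M" using N(3) pM by blast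
      fix N' assume N': "gr_submodule \<Gamma> R M N' \<and> N' \<noteq> carrier M \<and> N \<subseteq> N'"
      show "N' = N"
      proof (rule N_max)
        show "p \<notin> N'"
        proof
          assume pN': "p \<in> N'"
          interpret N': additive_subgroup N' M using N' by (simp add: gr_submodule_def)
          have "x \<in> N'" if x: "x \<in> carrier M" for x
          proof -
            \<comment> \<open>Being p f(x), this is a right multiple of \<open>p\<close>.
              Subtracting it from \<open>?g x\<close>, which lies in \<open>K\<close>, leaves
              \<open>x\<close>.\<close>
            have "p \<star> x \<in> N'"
              using N' pN' f_closed[OF x] by (simp add: gr_submodule_def star_def)
            moreover have "?g x \<in> N'" using N' N(2) x by (auto simp: K_def)
            ultimately have "?g x \<oplus>\<^bsub>M\<^esub> \<ominus>\<^bsub>M\<^esub> (p \<star> x) \<in> N'"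
              using M.abelian_group_axioms by blast
            then show ?thesis using x pM by (simp add: star_closed M.a_assoc M.r_neg)
          qed
          then show False using N' N'.a_subset by blast
        qed
      qed (use N' in auto)
    qed (rule N(1))
    then show False using no_max by blast
  qed
  then have "\<ominus>\<^bsub>M\<^esub> p \<in> K"
    using K additive_subgroup.a_inv_closed by (auto simp: gr_submodule_def)
  then obtain x where x: "x \<in> carrier M" "\<ominus>\<^bsub>M\<^esub> p = ?g x" by (auto simp: K_def)
  \<comment> \<open>The preimage \<open>x\<close> need not be homogeneous. As \<open>?g\<close>
    commutes with components and \<open>- p\<close> has degree \<open>\<sigma>\<close>, the
    component of \<open>x\<close> in that degree is a preimage as well.\<close>
  define y where "y = ?c \<sigma> x"
  have y: "y \<in> homog M \<sigma>" unfolding y_def by (rule component_in[OF Mc x(1) \<sigma>])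
  have yM: "y \<in> carrier M" by (rule homog_carrier[OF \<sigma> y])
  have "\<ominus>\<^bsub>M\<^esub> p \<in> homog M \<sigma>"
    using p additive_subgroup.a_inv_closed[OF homog_subgroup[OF \<sigma>]] by blast
  then have "\<ominus>\<^bsub>M\<^esub> p = ?c \<sigma> (\<ominus>\<^bsub>M\<^esub> p)" by (simp add: component_homog[OF Mc \<sigma>])
  also have "\<dots> = ?g y" unfolding x(2) y_def by (rule gr_hom_component[OF Mm Mm g x(1)])
  finally have "p \<oplus>\<^bsub>M\<^esub> ?g y = \<zero>\<^bsub>M\<^esub>" using pM by (metis M.r_neg)
  then show ?thesis using y yM pM by (intro bexI[of _ y]) (simp_all add: star_closed M.a_assoc)
qed

text \<open>The circle composition p o y = p + y + p \<star> y is associative with neutral element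
  zero. If \<open>y\<close> is a right inverse of \<open>p\<close> and \<open>z\<close> one of
  \<open>y\<close>, then p = p o (y o z) = (p o y) o z = z, hence y o p = 0.\<close>

lemma ex_quasi_inverse:
  assumes no_max: "\<nexists>N. gr_maximal \<Gamma> R M N" and p: "p \<in> homog M \<sigma>"
  obtains y where "y \<in> homog M \<sigma>" "y \<oplus>\<^bsub>M\<^esub> p \<oplus>\<^bsub>M\<^esub> y \<star> p = \<zero>\<^bsub>M\<^esub>"
proof -
  obtain y where y: "y \<in> homog M \<sigma>" "p \<oplus>\<^bsub>M\<^esub> y \<oplus>\<^bsub>M\<^esub> p \<star> y = \<zero>\<^bsub>M\<^esub>"
    using ex_right_quasi_inverse[OF assms] by blast
  obtain z where z: "z \<in> homog M \<sigma>" "y \<oplus>\<^bsub>M\<^esub> z \<oplus>\<^bsub>M\<^esub> y \<star> z = \<zero>\<^bsub>M\<^esub>"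
    using ex_right_quasi_inverse[OF no_max y(1)] by blast
  note carr = homog_carrier[OF \<sigma> p] homog_carrier[OF \<sigma> y(1)] homog_carrier[OF \<sigma> z(1)]
  have "p = p \<oplus>\<^bsub>M\<^esub> (y \<oplus>\<^bsub>M\<^esub> z \<oplus>\<^bsub>M\<^esub> y \<star> z) \<oplus>\<^bsub>M\<^esub> p \<star> (y \<oplus>\<^bsub>M\<^esub> z \<oplus>\<^bsub>M\<^esub> y \<star> z)"
    using carr by (simp add: z(2) star_zero)
  also have "\<dots> = (p \<oplus>\<^bsub>M\<^esub> y \<oplus>\<^bsub>M\<^esub> p \<star> y) \<oplus>\<^bsub>M\<^esub> z \<oplus>\<^bsub>M\<^esub> (p \<oplus>\<^bsub>M\<^esub> y \<oplus>\<^bsub>M\<^esub> p \<star> y) \<star> z"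
    using carr by (simp add: star_closed star_add_left star_add_right star_assoc M.a_ac)
  also have "\<dots> = z" using carr by (simp add: y(2) star_zero)
  finally show thesis using y(1) z(2) by (intro that[of y]) simp_all
qed

text \<open>As operators, (1 + y)(1 + p) = 1 + (y + p + y \<star> p), and the bracket is
  zero.\<close>

lemma one_plus_star_left_inverse:
  assumes "p \<in> carrier M" "y \<in> carrier M" "x \<in> carrier M" "y \<oplus>\<^bsub>M\<^esub> p \<oplus>\<^bsub>M\<^esub> y \<star> p = \<zero>\<^bsub>M\<^esub>"
  shows "(x \<oplus>\<^bsub>M\<^esub> p \<star> x) \<oplus>\<^bsub>M\<^esub> y \<star> (x \<oplus>\<^bsub>M\<^esub> p \<star> x) = x"
proof -
  have "(x \<oplus>\<^bsub>M\<^esub> p \<star> x) \<oplus>\<^bsub>M\<^esub> y \<star> (x \<oplus>\<^bsub>M\<^esub> p \<star> x) = x \<oplus>\<^bsub>M\<^esub> (y \<oplus>\<^bsub>M\<^esub> p \<oplus>\<^bsub>M\<^esub> y \<star> p) \<star> x"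
    using assms(1-3) by (simp add: star_closed star_add_left star_add_right star_assoc M.a_ac)
  then show ?thesis using assms by (simp add: star_zero)
qed

end

text \<open>This is Nakayama's lemma for the left ideal generated by the coordinates \<open>f i x\<close>, proved by
  Gaussian elimination: the last coordinate is expressed through the others, and the \<open>p i\<close> are
  modified accordingly.\<close>

lemma (in graded_right_module) dual_basis_elimination:
  assumes no_max: "\<nexists>N. gr_maximal \<Gamma> R M N" and x: "x \<in> carrier M" and "finite S"
    and "\<And>i. i \<in> S \<Longrightarrow> \<sigma> i \<in> carrier \<Gamma>"
    and "\<And>i. i \<in> S \<Longrightarrow> p i \<in> homog M (\<sigma> i)"
    and "\<And>i. i \<in> S \<Longrightarrow> f i \<in> gr_hom \<Gamma> R M (shifted (\<sigma> i))"
    and "x = finsum M (\<lambda>i. ract M (p i) (f i x)) S"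
  shows "x = \<zero>\<^bsub>M\<^esub>"
  using assms(3-)
\<comment> \<open>The generators \<open>p\<close> are generalised because the elimination changes
  them, while the degrees and the functionals stay fixed.\<close>
proof (induction S arbitrary: p rule: finite_induct)
  case empty
  then show ?case by simp
next
  case (insert n S)
  note MG = M.abelian_group_axioms
  interpret n: graded_functional \<Gamma> R M "\<sigma> n" "f n"
    by unfold_locales (use insert.prems in auto)
  have fc: "f i v \<in> carrier R" if "i \<in> S" "v \<in> carrier M" for i v
    using gr_homD(2)[OF insert.prems(3), of i v] that by simp
  have pc: "p i \<in> carrier M" if "i \<in> insert n S" for i
    using homog_carrier[OF insert.prems(1,2)[OF that]] .
  let ?w = "finsum M (\<lambda>i. ract M (p i) (f i x)) S"
  have wc: "?w \<in> carrier M" by (rule M.finsum_closed) (use fc pc x in \<open>auto intro: ract_closed\<close>)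
  have neg: "\<ominus>\<^bsub>M\<^esub> p n \<in> homog M (\<sigma> n)"
    using insert.prems additive_subgroup.a_inv_closed[OF homog_subgroup] by simp
  \<comment> \<open>With this \<open>y\<close>, the operator 1 + y is a left inverse of the operator
    sending v to v - p_n f_n(v).\<close>
  obtain y where y: "y \<in> homog M (\<sigma> n)" "y \<oplus>\<^bsub>M\<^esub> \<ominus>\<^bsub>M\<^esub> p n \<oplus>\<^bsub>M\<^esub> n.star y (\<ominus>\<^bsub>M\<^esub> p n) = \<zero>\<^bsub>M\<^esub>"
    using n.ex_quasi_inverse[OF no_max neg] .
  have yc: "y \<in> carrier M" using homog_carrier[OF n.\<sigma> y(1)] .
  let ?a = "n.star (p n) x" and ?b = "n.star (\<ominus>\<^bsub>M\<^esub> p n) x"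
  have ab: "?a \<in> carrier M" "?b \<in> carrier M" using pc[of n] x n.star_closed by simp_all
  have "finsum M (\<lambda>i. ract M (p i) (f i x)) (insert n S) = ?a \<oplus>\<^bsub>M\<^esub> ?w"
    unfolding n.star_def
    by (rule M.finsum_insert) (use insert.hyps pc fc x n.f_closed in \<open>auto intro!: ract_closed\<close>)
  with insert.prems(4) have "x = ?a \<oplus>\<^bsub>M\<^esub> ?w" by (rule trans)
  \<comment> \<open>Moving the term of index \<open>n\<close> to the other side: x - p_n f_n(x) is
    the sum \<open>?w\<close> of the remaining terms.\<close>
  then have "x \<oplus>\<^bsub>M\<^esub> ?b = (?a \<oplus>\<^bsub>M\<^esub> ?w) \<oplus>\<^bsub>M\<^esub> ?b" by (rule arg_cong)
  also have "\<dots> = (?b \<oplus>\<^bsub>M\<^esub> ?a) \<oplus>\<^bsub>M\<^esub> ?w" using ab wc by (simp add: M.a_ac)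
  also have "?b \<oplus>\<^bsub>M\<^esub> ?a = \<zero>\<^bsub>M\<^esub>"
    using n.star_add_left[of "\<ominus>\<^bsub>M\<^esub> p n" "p n" x] pc x by (simp add: M.l_neg n.star_zero)
  finally have w: "x \<oplus>\<^bsub>M\<^esub> ?b = ?w" using wc by simp
  \<comment> \<open>The left inverse recovers \<open>x\<close> from \<open>?w\<close>, so only terms
    with index in \<open>S\<close> remain. Distributing it over the sum replaces each p_i by p_i + y
    \<star> p_i.\<close>
  have "x = ?w \<oplus>\<^bsub>M\<^esub> n.star y ?w"
    by (rule n.one_plus_star_left_inverse[OF _ yc x y(2), unfolded w, symmetric]) (simp add: pc)
  also have "n.star y ?w = finsum M (\<lambda>i. n.star y (ract M (p i) (f i x))) S"
    by (rule additive_hom_finsum(2)[OF MG MG])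
      (use yc pc fc x in \<open>auto intro!: n.star_closed n.star_add_right ract_closed\<close>)
  also have "?w \<oplus>\<^bsub>M\<^esub> \<dots> = finsum M (\<lambda>i. ract M (p i) (f i x) \<oplus>\<^bsub>M\<^esub> n.star y (ract M (p i) (f i x))) S"
    by (rule M.finsum_addf[symmetric])
      (use yc pc fc x in \<open>auto intro!: n.star_closed ract_closed\<close>)
  also have "\<dots> = finsum M (\<lambda>i. ract M (p i \<oplus>\<^bsub>M\<^esub> n.star y (p i)) (f i x)) S"
    by (rule M.finsum_cong')
      (use yc pc fc x in \<open>auto simp: n.star_ract ract_add_left n.star_closed intro!: ract_closed\<close>)
  finally have "x = finsum M (\<lambda>i. ract M (p i \<oplus>\<^bsub>M\<^esub> n.star y (p i)) (f i x)) S" .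
  \<comment> \<open>Left multiplication by the homogeneous \<open>y\<close> preserves every degree,
    so the new generators still match the old functionals.\<close>
  moreover have "p i \<oplus>\<^bsub>M\<^esub> n.star y (p i) \<in> homog M (\<sigma> i)" if "i \<in> S" for i
    using that insert.prems n.star_homog[OF y(1)] additive_subgroup.a_closed[OF homog_subgroup] by simp
  ultimately show ?case
    using insert.prems by (intro insert.IH[of "\<lambda>i. p i \<oplus>\<^bsub>M\<^esub> n.star y (p i)"]) auto
qed

section \<open>Direct sums of graded modules\<close>

text \<open>Elements are finitely supported functions on \<open>J\<close>, made extensional so that
  agreement on \<open>J\<close> implies equality. The degree \<open>\<tau>\<close> part consists of
  the functions all of whose coordinates have degree \<open>\<tau>\<close>.\<close>

definition gr_direct_sum :: "'i set \<Rightarrow> ('i \<Rightarrow> ('m, 'g, 'r) graded_rmod) \<Rightarrow> ('i \<Rightarrow> 'm, 'g, 'r) graded_rmod" where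
  "gr_direct_sum J M = \<lparr>carrier = {u \<in> \<Pi>\<^sub>E i\<in>J. carrier (M i). finite {i \<in> J. u i \<noteq> \<zero>\<^bsub>M i\<^esub>}},
    mult = undefined, one = undefined, zero = (\<lambda>i\<in>J. \<zero>\<^bsub>M i\<^esub>), add = (\<lambda>u v. \<lambda>i\<in>J. u i \<oplus>\<^bsub>M i\<^esub> v i),
    homog = (\<lambda>\<tau>. {u \<in> \<Pi>\<^sub>E i\<in>J. homog (M i) \<tau>. finite {i \<in> J. u i \<noteq> \<zero>\<^bsub>M i\<^esub>}}),
    ract = (\<lambda>u r. \<lambda>i\<in>J. ract (M i) (u i) r)\<rparr>"

lemma gr_direct_sum_simps:
  "u \<in> carrier (gr_direct_sum J M) \<longleftrightarrow> u \<in> (\<Pi>\<^sub>E i\<in>J. carrier (M i)) \<and> finite {i \<in> J. u i \<noteq> \<zero>\<^bsub>M i\<^esub>}"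
  "\<zero>\<^bsub>gr_direct_sum J M\<^esub> = (\<lambda>i\<in>J. \<zero>\<^bsub>M i\<^esub>)"
  "u \<oplus>\<^bsub>gr_direct_sum J M\<^esub> v = (\<lambda>i\<in>J. u i \<oplus>\<^bsub>M i\<^esub> v i)"
  "ract (gr_direct_sum J M) u r = (\<lambda>i\<in>J. ract (M i) (u i) r)"
  "u \<in> homog (gr_direct_sum J M) \<tau> \<longleftrightarrow> u \<in> (\<Pi>\<^sub>E i\<in>J. homog (M i) \<tau>) \<and> finite {i \<in> J. u i \<noteq> \<zero>\<^bsub>M i\<^esub>}"
  by (auto simp: gr_direct_sum_def)

text \<open>This is the map out of the direct sum induced by the \<open>\<psi> i\<close>. The sum
  runs over the support because \<open>finsum\<close> over an infinite index set is zero by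
  convention.\<close>

definition cotuple ::
  "'i set \<Rightarrow> ('i \<Rightarrow> ('m, 'g, 'r) graded_rmod) \<Rightarrow> ('n, 'g, 'r) graded_rmod \<Rightarrow> ('i \<Rightarrow> 'm \<Rightarrow> 'n) \<Rightarrow> ('i \<Rightarrow> 'm) \<Rightarrow> 'n" where
  "cotuple J M N \<psi> u = finsum N (\<lambda>i. \<psi> i (u i)) {i \<in> J. u i \<noteq> \<zero>\<^bsub>M i\<^esub>}"

context
  fixes \<Gamma> :: "'g arrows" and R :: "('r, 'g) graded" and J :: "'i set"
    and M :: "'i \<Rightarrow> ('m, 'g, 'r) graded_rmod"
  assumes R: "graded_ring \<Gamma> R" and M: "\<And>i. i \<in> J \<Longrightarrow> graded_right_module \<Gamma> R (M i)"
begin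

lemma summand_group: "i \<in> J \<Longrightarrow> abelian_group (M i)"
  using M by (simp add: graded_right_module_def)

lemma summand_group_laws:
  assumes "i \<in> J"
  shows "\<zero>\<^bsub>M i\<^esub> \<in> carrier (M i)"
    and "x \<in> carrier (M i) \<Longrightarrow> y \<in> carrier (M i) \<Longrightarrow> x \<oplus>\<^bsub>M i\<^esub> y \<in> carrier (M i)"
    and "x \<in> carrier (M i) \<Longrightarrow> \<ominus>\<^bsub>M i\<^esub> x \<in> carrier (M i)"
    and "x \<in> carrier (M i) \<Longrightarrow> \<zero>\<^bsub>M i\<^esub> \<oplus>\<^bsub>M i\<^esub> x = x"
    and "x \<in> carrier (M i) \<Longrightarrow> \<ominus>\<^bsub>M i\<^esub> x \<oplus>\<^bsub>M i\<^esub> x = \<zero>\<^bsub>M i\<^esub>"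
    and "x \<in> carrier (M i) \<Longrightarrow> y \<in> carrier (M i) \<Longrightarrow> x \<oplus>\<^bsub>M i\<^esub> y = y \<oplus>\<^bsub>M i\<^esub> x"
    and "x \<in> carrier (M i) \<Longrightarrow> y \<in> carrier (M i) \<Longrightarrow> z \<in> carrier (M i) \<Longrightarrow>
      x \<oplus>\<^bsub>M i\<^esub> y \<oplus>\<^bsub>M i\<^esub> z = x \<oplus>\<^bsub>M i\<^esub> (y \<oplus>\<^bsub>M i\<^esub> z)"
    and "\<ominus>\<^bsub>M i\<^esub> \<zero>\<^bsub>M i\<^esub> = \<zero>\<^bsub>M i\<^esub>"
proof -
  interpret abelian_group "M i" by (rule summand_group[OF assms])
  show "\<ominus>\<^bsub>M i\<^esub> \<zero>\<^bsub>M i\<^esub> = \<zero>\<^bsub>M i\<^esub>" by (rule minus_equality) auto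
qed (use abelian_groupE[OF summand_group[OF assms]] abelian_group.a_inv_closed[OF summand_group[OF assms]]
    abelian_group.l_neg[OF summand_group[OF assms]] in auto)

lemma support_add:
  assumes "u \<in> (\<Pi>\<^sub>E i\<in>J. carrier (M i))" "v \<in> (\<Pi>\<^sub>E i\<in>J. carrier (M i))"
  shows "{i \<in> J. u i \<oplus>\<^bsub>M i\<^esub> v i \<noteq> \<zero>\<^bsub>M i\<^esub>} \<subseteq> {i \<in> J. u i \<noteq> \<zero>\<^bsub>M i\<^esub>} \<union> {i \<in> J. v i \<noteq> \<zero>\<^bsub>M i\<^esub>}"
  using summand_group_laws(1,4) by auto

lemma abelian_group_gr_direct_sum: "abelian_group (gr_direct_sum J M)"
proof (rule abelian_groupI)
  fix u v assume u: "u \<in> carrier (gr_direct_sum J M)" and v: "v \<in> carrier (gr_direct_sum J M)"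
  have "finite {i \<in> J. u i \<oplus>\<^bsub>M i\<^esub> v i \<noteq> \<zero>\<^bsub>M i\<^esub>}"
    by (rule finite_subset[OF support_add]) (use u v in \<open>auto simp: gr_direct_sum_simps\<close>)
  moreover have "{i \<in> J. (\<lambda>i\<in>J. u i \<oplus>\<^bsub>M i\<^esub> v i) i \<noteq> \<zero>\<^bsub>M i\<^esub>} = {i \<in> J. u i \<oplus>\<^bsub>M i\<^esub> v i \<noteq> \<zero>\<^bsub>M i\<^esub>}"
    by auto
  ultimately show "u \<oplus>\<^bsub>gr_direct_sum J M\<^esub> v \<in> carrier (gr_direct_sum J M)"
    using u v summand_group_laws(2) by (auto simp: gr_direct_sum_simps PiE_iff)
  show "u \<oplus>\<^bsub>gr_direct_sum J M\<^esub> v = v \<oplus>\<^bsub>gr_direct_sum J M\<^esub> u"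
    using u v summand_group_laws(6) by (auto simp: gr_direct_sum_simps PiE_iff)
  show "\<zero>\<^bsub>gr_direct_sum J M\<^esub> \<oplus>\<^bsub>gr_direct_sum J M\<^esub> u = u"
    using u summand_group_laws(4) by (fastforce simp: gr_direct_sum_simps PiE_iff extensional_def)
  show "u \<oplus>\<^bsub>gr_direct_sum J M\<^esub> v \<oplus>\<^bsub>gr_direct_sum J M\<^esub> w = u \<oplus>\<^bsub>gr_direct_sum J M\<^esub> (v \<oplus>\<^bsub>gr_direct_sum J M\<^esub> w)"
    if "w \<in> carrier (gr_direct_sum J M)" for w
    using u v that summand_group_laws(7) by (auto simp: gr_direct_sum_simps PiE_iff)
  have "{i \<in> J. \<ominus>\<^bsub>M i\<^esub> u i \<noteq> \<zero>\<^bsub>M i\<^esub>} \<subseteq> {i \<in> J. u i \<noteq> \<zero>\<^bsub>M i\<^esub>}"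
    using summand_group_laws(8) by auto
  moreover have "{i \<in> J. (\<lambda>i\<in>J. \<ominus>\<^bsub>M i\<^esub> u i) i \<noteq> \<zero>\<^bsub>M i\<^esub>} = {i \<in> J. \<ominus>\<^bsub>M i\<^esub> u i \<noteq> \<zero>\<^bsub>M i\<^esub>}"
    by auto
  ultimately have "finite {i \<in> J. (\<lambda>i\<in>J. \<ominus>\<^bsub>M i\<^esub> u i) i \<noteq> \<zero>\<^bsub>M i\<^esub>}"
    using u by (simp add: gr_direct_sum_simps finite_subset)
  then have "(\<lambda>i\<in>J. \<ominus>\<^bsub>M i\<^esub> u i) \<in> carrier (gr_direct_sum J M)"
    using u summand_group_laws(3) by (simp only: gr_direct_sum_simps) (auto simp: PiE_iff)
  moreover have "(\<lambda>i\<in>J. \<ominus>\<^bsub>M i\<^esub> u i) \<oplus>\<^bsub>gr_direct_sum J M\<^esub> u = \<zero>\<^bsub>gr_direct_sum J M\<^esub>"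
    using u summand_group_laws(5) by (auto simp: gr_direct_sum_simps PiE_iff)
  ultimately show "\<exists>y\<in>carrier (gr_direct_sum J M). y \<oplus>\<^bsub>gr_direct_sum J M\<^esub> u = \<zero>\<^bsub>gr_direct_sum J M\<^esub>"
    by blast
qed (use summand_group_laws(1) in \<open>auto simp: gr_direct_sum_simps\<close>)

text \<open>All operations and projections are taken coordinatewise; only the finiteness of supports
  needs an argument.\<close>

lemma graded_right_module_gr_direct_sum: "graded_right_module \<Gamma> R (gr_direct_sum J M)"
proof -
  interpret R: graded_ring \<Gamma> R by (rule R)
  let ?D = "gr_direct_sum J M"
  note DG = abelian_group_gr_direct_sum
  have Mdir: "internal_direct_sum (M i) (carrier \<Gamma>) (homog (M i)) (carrier (M i))" if "i \<in> J" for i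
    using graded_right_module.mod_grading[OF M[OF that]] .
  note Mc = summand_group Mdir
  let ?c = "\<lambda>i. component (M i) (carrier \<Gamma>) (homog (M i))"
  define \<pi> where "\<pi> \<tau> u = (\<lambda>i\<in>J. ?c i \<tau> (u i))" for \<tau> u
  have restr: "{i \<in> J. (\<lambda>i\<in>J. w i) i \<noteq> \<zero>\<^bsub>M i\<^esub>} = {i \<in> J. w i \<noteq> \<zero>\<^bsub>M i\<^esub>}" for w by auto
  have supp_fin: "finite {i \<in> J. w i \<noteq> \<zero>\<^bsub>M i\<^esub>}"
    if "u \<in> carrier ?D" "\<And>i. i \<in> J \<Longrightarrow> u i = \<zero>\<^bsub>M i\<^esub> \<Longrightarrow> w i = \<zero>\<^bsub>M i\<^esub>" for u w
    by (rule finite_subset[of _ "{i \<in> J. u i \<noteq> \<zero>\<^bsub>M i\<^esub>}"]) (use that in \<open>auto simp: gr_direct_sum_simps\<close>)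
  have uM: "u i \<in> carrier (M i)" if "u \<in> carrier ?D" "i \<in> J" for u i
    using that by (auto simp: gr_direct_sum_simps)
  have ext: "u = v" if "u \<in> carrier ?D" "v \<in> carrier ?D" "\<And>i. i \<in> J \<Longrightarrow> u i = v i" for u v
    using that by (auto simp: gr_direct_sum_simps intro: PiE_ext)
  have hM: "homog ?D \<tau> \<subseteq> carrier ?D" if "\<tau> \<in> carrier \<Gamma>" for \<tau>
    using summand_closed[OF Mc] that by (fastforce simp: gr_direct_sum_simps PiE_iff)
  have c0: "?c i \<tau> \<zero>\<^bsub>M i\<^esub> = \<zero>\<^bsub>M i\<^esub>" if "i \<in> J" for i \<tau>
    by (rule component_zero[OF Mc[OF that]])
  have \<pi>_homog: "\<pi> \<tau> u \<in> homog ?D \<tau>" if "\<tau> \<in> carrier \<Gamma>" "u \<in> carrier ?D" for \<tau> u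
    unfolding gr_direct_sum_simps \<pi>_def restr
    using component_in[OF Mc] uM[OF that(2)] that(1) supp_fin[OF that(2), of "\<lambda>i. ?c i \<tau> (u i)"] c0 by auto
  have dir: "internal_direct_sum ?D (carrier \<Gamma>) (homog ?D) (carrier ?D)"
  proof (rule internal_direct_sumI[OF DG hM \<pi>_homog])
    show "\<pi> \<tau> (u \<oplus>\<^bsub>?D\<^esub> v) = \<pi> \<tau> u \<oplus>\<^bsub>?D\<^esub> \<pi> \<tau> v"
      if "\<tau> \<in> carrier \<Gamma>" "u \<in> carrier ?D" "v \<in> carrier ?D" for \<tau> u v
      using uM[OF that(2)] uM[OF that(3)] component_add[OF Mc]
      by (auto simp: \<pi>_def gr_direct_sum_simps)
  next
    fix \<tau> u assume \<tau>: "\<tau> \<in> carrier \<Gamma>" and u: "u \<in> homog ?D \<tau>"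
    then have uh: "u i \<in> homog (M i) \<tau>" if "i \<in> J" for i using that by (auto simp: gr_direct_sum_simps)
    show "\<pi> \<tau> u = u"
    proof (rule ext)
      show u': "u \<in> carrier ?D" using hM[OF \<tau>] u by blast
      show "\<pi> \<tau> u \<in> carrier ?D" using hM[OF \<tau>] \<pi>_homog[OF \<tau> u'] by blast
      show "\<pi> \<tau> u i = u i" if "i \<in> J" for i
        using component_homog[OF Mc[OF that] \<tau> uh[OF that]] that by (simp add: \<pi>_def)
    qed
    show "\<pi> \<tau>' u = \<zero>\<^bsub>?D\<^esub>" if "\<tau>' \<in> carrier \<Gamma>" "\<tau> \<noteq> \<tau>'" for \<tau>'
      using component_homog[OF Mc \<tau> uh] that by (auto simp: \<pi>_def gr_direct_sum_simps)
  next
    fix u assume u: "u \<in> carrier ?D"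
    \<comment> \<open>A degree that occurs in \<open>u\<close> occurs in one of its finitely many
      nonzero coordinates, each of which has finitely many nonzero components.\<close>
    have "{\<tau> \<in> carrier \<Gamma>. \<pi> \<tau> u \<noteq> \<zero>\<^bsub>?D\<^esub>} \<subseteq> (\<Union>i\<in>{i \<in> J. u i \<noteq> \<zero>\<^bsub>M i\<^esub>}. {\<tau>. ?c i \<tau> (u i) \<noteq> \<zero>\<^bsub>M i\<^esub>})"
    proof
      fix \<tau> assume "\<tau> \<in> {\<tau> \<in> carrier \<Gamma>. \<pi> \<tau> u \<noteq> \<zero>\<^bsub>?D\<^esub>}"
      then obtain i where "i \<in> J" "?c i \<tau> (u i) \<noteq> \<zero>\<^bsub>M i\<^esub>"
        unfolding \<pi>_def gr_direct_sum_simps by (metis (mono_tags, lifting) mem_Collect_eq restrict_ext)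
      then show "\<tau> \<in> (\<Union>i\<in>{i \<in> J. u i \<noteq> \<zero>\<^bsub>M i\<^esub>}. {\<tau>. ?c i \<tau> (u i) \<noteq> \<zero>\<^bsub>M i\<^esub>})"
        using c0 by auto
    qed
    moreover have "finite (\<Union>i\<in>{i \<in> J. u i \<noteq> \<zero>\<^bsub>M i\<^esub>}. {\<tau>. ?c i \<tau> (u i) \<noteq> \<zero>\<^bsub>M i\<^esub>})"
      using u finite_component[OF Mc] uM[OF u] by (auto simp: gr_direct_sum_simps)
    ultimately show "finite {\<tau> \<in> carrier \<Gamma>. \<pi> \<tau> u \<noteq> \<zero>\<^bsub>?D\<^esub>}" by (rule finite_subset)
    assume \<pi>0: "\<And>\<tau>. \<tau> \<in> carrier \<Gamma> \<Longrightarrow> \<pi> \<tau> u = \<zero>\<^bsub>?D\<^esub>"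
    show "u = \<zero>\<^bsub>?D\<^esub>"
    proof (rule ext[OF u])
      show "\<zero>\<^bsub>?D\<^esub> \<in> carrier ?D" using abelian_groupE(2)[OF DG] .
      fix i assume i: "i \<in> J"
      have "?c i \<tau> (u i) = \<zero>\<^bsub>M i\<^esub>" if "\<tau> \<in> carrier \<Gamma>" for \<tau>
        using fun_cong[OF \<pi>0[OF that], of i] i by (simp add: \<pi>_def gr_direct_sum_simps)
      then show "u i = \<zero>\<^bsub>?D\<^esub> i"
        using component_sep[OF Mc[OF i] uM[OF u i]] i by (simp add: gr_direct_sum_simps)
    qed
  qed
  have act: "(\<lambda>i\<in>J. ract (M i) (u i) r) \<in> carrier ?D" if "u \<in> carrier ?D" "r \<in> carrier R" for u r
    unfolding gr_direct_sum_simps restr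
    using supp_fin[OF that(1), of "\<lambda>i. ract (M i) (u i) r"] uM[OF that(1)] that(2)
      graded_right_module.ract_closed[OF M] graded_right_module.ract_zero_left[OF M] by auto
  have act_homog: "(\<lambda>i\<in>J. ract (M i) (u i) r) \<in> homog ?D (cmp \<Gamma> \<sigma> \<tau>)"
    if "\<sigma> \<in> carrier \<Gamma>" "\<tau> \<in> carrier \<Gamma>" "src \<Gamma> \<sigma> = tgt \<Gamma> \<tau>" "u \<in> homog ?D \<sigma>" "r \<in> homog R \<tau>" for u r \<sigma> \<tau>
  proof -
    have u: "u \<in> carrier ?D" using hM that by blast
    have r: "r \<in> carrier R" using R.homog_closed that by blast
    show ?thesis
      unfolding gr_direct_sum_simps restr
      using supp_fin[OF u, of "\<lambda>i. ract (M i) (u i) r"] graded_right_module.ract_zero_left[OF M r]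
        graded_right_module.homog_ract[OF M that(1-3) _ that(5)] that(4)
      by (auto simp: gr_direct_sum_simps PiE_iff)
  qed
  show ?thesis
  proof (intro graded_right_module.intro graded_right_module_axioms.intro R DG dir)
    show "ract ?D u r \<in> carrier ?D" if "u \<in> carrier ?D" "r \<in> carrier R" for u r
      using act[OF that] by (simp add: gr_direct_sum_simps(4))
    show "ract ?D (u \<oplus>\<^bsub>?D\<^esub> v) r = ract ?D u r \<oplus>\<^bsub>?D\<^esub> ract ?D v r"
      if "u \<in> carrier ?D" "v \<in> carrier ?D" "r \<in> carrier R" for u v r
      using uM[OF that(1)] uM[OF that(2)] graded_right_module.ract_add_left[OF M] that(3)
      by (auto simp: gr_direct_sum_simps(3,4))
    show "ract ?D u (r \<oplus>\<^bsub>R\<^esub> s) = ract ?D u r \<oplus>\<^bsub>?D\<^esub> ract ?D u s"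
      if "u \<in> carrier ?D" "r \<in> carrier R" "s \<in> carrier R" for u r s
      using uM[OF that(1)] graded_right_module.ract_add_right[OF M] that(2,3)
      by (auto simp: gr_direct_sum_simps(3,4))
    show "ract ?D u (r \<otimes>\<^bsub>R\<^esub> s) = ract ?D (ract ?D u r) s"
      if "u \<in> carrier ?D" "r \<in> carrier R" "s \<in> carrier R" for u r s
      using uM[OF that(1)] graded_right_module.ract_assoc[OF M] that(2,3)
      by (auto simp: gr_direct_sum_simps(4))
    show "ract ?D u r \<in> homog ?D (cmp \<Gamma> \<sigma> \<tau>)"
      if "\<sigma> \<in> carrier \<Gamma>" "\<tau> \<in> carrier \<Gamma>" "src \<Gamma> \<sigma> = tgt \<Gamma> \<tau>" "u \<in> homog ?D \<sigma>" "r \<in> homog R \<tau>" for u r \<sigma> \<tau>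
      using act_homog[OF that] by (simp add: gr_direct_sum_simps(4))
    show "ract ?D u r = \<zero>\<^bsub>?D\<^esub>"
      if "\<sigma> \<in> carrier \<Gamma>" "\<tau> \<in> carrier \<Gamma>" "src \<Gamma> \<sigma> \<noteq> tgt \<Gamma> \<tau>" "u \<in> homog ?D \<sigma>" "r \<in> homog R \<tau>" for u r \<sigma> \<tau>
      using graded_right_module.homog_ract_zero[OF M that(1-3) _ that(5)] that(4)
      by (auto simp: gr_direct_sum_simps PiE_iff)
    show "ract ?D u (obj_one R (src \<Gamma> \<sigma>)) = u" if "\<sigma> \<in> carrier \<Gamma>" "u \<in> homog ?D \<sigma>" for u \<sigma>
    proof (rule ext)
      show u: "u \<in> carrier ?D" using hM that by blast
      show "ract ?D u (obj_one R (src \<Gamma> \<sigma>)) \<in> carrier ?D"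
        unfolding gr_direct_sum_simps(4) by (rule act[OF u R.obj_one_closed[OF that(1)]])
      show "ract ?D u (obj_one R (src \<Gamma> \<sigma>)) i = u i" if "i \<in> J" for i
        using graded_right_module.ract_obj_one[OF M[OF that] \<open>\<sigma> \<in> carrier \<Gamma>\<close>, of "u i"] that
          \<open>u \<in> homog ?D \<sigma>\<close> by (auto simp: gr_direct_sum_simps)
    qed
  qed
qed

lemma gr_direct_sum_coordinate:
  assumes "i \<in> J"
  shows "(\<lambda>u. u i) \<in> gr_hom \<Gamma> R (gr_direct_sum J M) (M i)"
  using assms by (auto simp: gr_hom_def gr_direct_sum_simps)

section \<open>Maps out of a direct sum\<close>

context
  fixes N :: "('n, 'g, 'r) graded_rmod" and \<psi>
  assumes N: "graded_right_module \<Gamma> R N" and \<psi>: "\<And>i. i \<in> J \<Longrightarrow> \<psi> i \<in> gr_hom \<Gamma> R (M i) N"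
begin

interpretation N: graded_right_module \<Gamma> R N by (rule N)

lemma cotuple_map_zero: "i \<in> J \<Longrightarrow> \<psi> i \<zero>\<^bsub>M i\<^esub> = \<zero>\<^bsub>N\<^esub>"
  by (rule additive_hom_zero[OF summand_group N.M.abelian_group_axioms gr_homD(1,3)[OF \<psi>]])

text \<open>Zero coordinates contribute nothing, so any finite set containing the support may be
  used. Additivity needs one common range for \<open>u\<close>, \<open>v\<close> and their
  sum.\<close>

lemma cotuple_eq:
  assumes "u \<in> carrier (gr_direct_sum J M)" "finite F" "F \<subseteq> J" "{i \<in> J. u i \<noteq> \<zero>\<^bsub>M i\<^esub>} \<subseteq> F"
  shows "cotuple J M N \<psi> u = finsum N (\<lambda>i. \<psi> i (u i)) F"
  unfolding cotuple_def
  by (rule N.M.add.finprod_mono_neutral_cong_left)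
    (use assms cotuple_map_zero gr_homD(2)[OF \<psi>] in \<open>auto simp: gr_direct_sum_simps PiE_iff subset_iff\<close>)

lemma cotuple_gr_hom: "cotuple J M N \<psi> \<in> gr_hom \<Gamma> R (gr_direct_sum J M) N"
proof -
  let ?D = "gr_direct_sum J M" and ?S = "\<lambda>u. {i \<in> J. u i \<noteq> \<zero>\<^bsub>M i\<^esub>}"
  interpret D: graded_right_module \<Gamma> R ?D by (rule graded_right_module_gr_direct_sum)
  have fin: "finite (?S u)" and uM: "\<And>i. i \<in> J \<Longrightarrow> u i \<in> carrier (M i)" if "u \<in> carrier ?D" for u
    using that by (auto simp: gr_direct_sum_simps)
  have \<psi>N: "\<psi> i (u i) \<in> carrier N" if "u \<in> carrier ?D" "i \<in> J" for u i
    using gr_homD(2)[OF \<psi>] uM that by blast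
  have closed: "cotuple J M N \<psi> u \<in> carrier N" if "u \<in> carrier ?D" for u
    unfolding cotuple_def by (rule N.M.finsum_closed) (use \<psi>N[OF that] in auto)
  have "cotuple J M N \<psi> (u \<oplus>\<^bsub>?D\<^esub> v) = cotuple J M N \<psi> u \<oplus>\<^bsub>N\<^esub> cotuple J M N \<psi> v"
    if u: "u \<in> carrier ?D" and v: "v \<in> carrier ?D" for u v
  proof -
    let ?F = "?S u \<union> ?S v"
    have F: "finite ?F" "?F \<subseteq> J" using fin u v by auto
    have "?S (u \<oplus>\<^bsub>?D\<^esub> v) \<subseteq> ?F"
      using support_add[of u v] u v by (auto simp: gr_direct_sum_simps)
    then have "cotuple J M N \<psi> (u \<oplus>\<^bsub>?D\<^esub> v) = finsum N (\<lambda>i. \<psi> i ((u \<oplus>\<^bsub>?D\<^esub> v) i)) ?F"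
      using D.M.a_closed[OF u v] F by (intro cotuple_eq)
    also have "\<dots> = finsum N (\<lambda>i. \<psi> i (u i) \<oplus>\<^bsub>N\<^esub> \<psi> i (v i)) ?F"
      by (rule N.M.finsum_cong')
        (use gr_homD(3)[OF \<psi>] uM[OF u] uM[OF v] \<psi>N[OF u] \<psi>N[OF v] in \<open>auto simp: gr_direct_sum_simps(3)\<close>)
    also have "\<dots> = finsum N (\<lambda>i. \<psi> i (u i)) ?F \<oplus>\<^bsub>N\<^esub> finsum N (\<lambda>i. \<psi> i (v i)) ?F"
      by (rule N.M.finsum_addf) (use \<psi>N[OF u] \<psi>N[OF v] in auto)
    also have "\<dots> = cotuple J M N \<psi> u \<oplus>\<^bsub>N\<^esub> cotuple J M N \<psi> v"
      using cotuple_eq[OF u F] cotuple_eq[OF v F] by simp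
    finally show ?thesis .
  qed
  moreover have "cotuple J M N \<psi> (ract ?D u r) = ract N (cotuple J M N \<psi> u) r"
    if u: "u \<in> carrier ?D" and r: "r \<in> carrier R" for u r
  proof -
    have "?S (ract ?D u r) \<subseteq> ?S u"
      using graded_right_module.ract_zero_left[OF M r] by (auto simp: gr_direct_sum_simps)
    then have "cotuple J M N \<psi> (ract ?D u r) = finsum N (\<lambda>i. \<psi> i (ract ?D u r i)) (?S u)"
      using D.ract_closed[OF u r] fin[OF u] by (intro cotuple_eq) auto
    also have "\<dots> = finsum N (\<lambda>i. ract N (\<psi> i (u i)) r) (?S u)"
      by (rule N.M.finsum_cong')
        (use gr_homD(4)[OF \<psi>] uM[OF u] \<psi>N[OF u] r N.ract_closed in \<open>auto simp: gr_direct_sum_simps(4)\<close>)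
    also have "\<dots> = ract N (cotuple J M N \<psi> u) r"
      unfolding cotuple_def
      by (rule additive_hom_finsum(2)[OF N.M.abelian_group_axioms N.M.abelian_group_axioms, symmetric])
        (use \<psi>N[OF u] r N.ract_closed N.ract_add_left in auto)
    finally show ?thesis .
  qed
  moreover have "cotuple J M N \<psi> u \<in> homog N \<tau>" if "\<tau> \<in> carrier \<Gamma>" "u \<in> homog ?D \<tau>" for u \<tau>
    unfolding cotuple_def
    by (rule additive_subgroup_finsum[OF N.M.abelian_group_axioms N.homog_subgroup])
      (use that gr_homD(5)[OF \<psi>] in \<open>auto simp: gr_direct_sum_simps\<close>)
  ultimately show ?thesis using closed by (auto simp: gr_hom_def)
qed

lemma in_cotuple_image:
  assumes i: "i \<in> J" and x: "x \<in> carrier (M i)"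
  shows "\<psi> i x \<in> cotuple J M N \<psi> ` carrier (gr_direct_sum J M)"
proof -
  define u where "u = (\<lambda>j\<in>J. if j = i then x else \<zero>\<^bsub>M j\<^esub>)"
  have supp: "{j \<in> J. u j \<noteq> \<zero>\<^bsub>M j\<^esub>} \<subseteq> {i}" by (auto simp: u_def)
  have u: "u \<in> carrier (gr_direct_sum J M)"
    using finite_subset[OF supp] summand_group_laws(1) x by (auto simp: gr_direct_sum_simps u_def)
  have "cotuple J M N \<psi> u = finsum N (\<lambda>i. \<psi> i (u i)) {i}"
    by (rule cotuple_eq[OF u _ _ supp]) (use i in auto)
  also have "\<dots> = \<psi> i x"
    using gr_homD(2)[OF \<psi>[OF i] x] i by (simp add: N.M.finsum_insert u_def)
  finally show ?thesis using u by (metis image_eqI)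
qed

end

end

section \<open>Dual bases of gr-projective modules\<close>

text \<open>The direct sum of one shifted module for each homogeneous element of \<open>P\<close>
  maps onto \<open>P\<close>. By projectivity this surjection splits, and the coordinates of the
  splitting are the functionals \<open>f\<close>.\<close>

lemma dual_basis:
  fixes P :: "('p, 'g, 'r) graded_rmod"
  assumes P: "graded_right_module \<Gamma> R P" and proj: "gr_projective \<Gamma> R P"
  obtains f where "\<And>\<sigma> p. \<sigma> \<in> carrier \<Gamma> \<Longrightarrow> p \<in> homog P \<sigma> \<Longrightarrow>
      f (\<sigma>, p) \<in> gr_hom \<Gamma> R P (graded_ring.shifted \<Gamma> R \<sigma>)"
    and "\<And>x. x \<in> carrier P \<Longrightarrow> \<exists>S. finite S \<and> S \<subseteq> Sigma (carrier \<Gamma>) (homog P) \<and>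
      x = finsum P (\<lambda>i. ract P (snd i) (f i x)) S"
proof -
  interpret P: graded_right_module \<Gamma> R P by fact
  note Pc = P.M.abelian_group_axioms P.mod_grading
  \<comment> \<open>A generator is indexed together with its degree, since zero is homogeneous of
    every degree.\<close>
  define J where "J = Sigma (carrier \<Gamma>) (homog P)"
  define M :: "'g \<times> 'p \<Rightarrow> ('r, 'g, 'r) graded_rmod" where "M i = P.shifted (fst i)" for i
  define \<psi> where "\<psi> i = ract P (snd i)" for i :: "'g \<times> 'p"
  let ?F = "gr_direct_sum J M"
  let ?g = "cotuple J M P \<psi>"
  have M: "graded_right_module \<Gamma> R (M i)" if "i \<in> J" for i
    unfolding M_def using that by (intro P.graded_right_module_shifted) (auto simp: J_def)
  have \<psi>: "\<psi> i \<in> gr_hom \<Gamma> R (M i) P" if "i \<in> J" for i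
    unfolding M_def \<psi>_def using that by (intro P.ract_shifted_gr_hom) (auto simp: J_def)
  note R = P.graded_ring_axioms
  have F: "graded_right_module \<Gamma> R ?F" by (rule graded_right_module_gr_direct_sum[OF R M])
  have g: "?g \<in> gr_hom \<Gamma> R ?F P" by (rule cotuple_gr_hom[OF R M P \<psi>])
  have img: "additive_subgroup (?g ` carrier ?F) P"
    using gr_submodule_image[OF F P g] by (simp add: gr_submodule_def)
  have "x \<in> ?g ` carrier ?F" if x: "x \<in> carrier P" for x
  \<comment> \<open>The image is a subgroup, so it suffices to reach the components of
    \<open>x\<close>. A component \<open>p\<close> of degree \<open>\<sigma>\<close> is the image of
    the generator 1_e in the summand indexed by \<open>(\<sigma>, p)\<close>.\<close>
  proof (rule component_induct[OF Pc x img])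
    fix \<sigma> assume \<sigma>: "\<sigma> \<in> carrier \<Gamma>"
    define p where "p = component P (carrier \<Gamma>) (homog P) \<sigma> x"
    define e where "e = obj_one R (src \<Gamma> \<sigma>)"
    have p: "p \<in> homog P \<sigma>" unfolding p_def by (rule component_in[OF Pc x \<sigma>])
    then have i: "(\<sigma>, p) \<in> J" using \<sigma> by (simp add: J_def)
    have "e \<in> carrier (M (\<sigma>, p))"
      using P.obj_one_homog[OF \<sigma>] P.is_identity_obj_one[of "src \<Gamma> \<sigma>"] P.obj_one_closed[OF \<sigma>] \<sigma>
      by (auto simp: M_def e_def is_identity_of_def identities_def)
    with i have "\<psi> (\<sigma>, p) e \<in> ?g ` carrier ?F" by (intro in_cotuple_image[OF R M P \<psi>])
    moreover have "\<psi> (\<sigma>, p) e = p" using P.ract_obj_one[OF \<sigma> p] by (simp add: \<psi>_def e_def)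
    ultimately show "component P (carrier \<Gamma>) (homog P) \<sigma> x \<in> ?g ` carrier ?F" by (simp add: p_def)
  qed
  then have surj: "?g ` carrier ?F = carrier P" using gr_homD(2)[OF g] by blast
  have id: "(\<lambda>x. x) \<in> gr_hom \<Gamma> R P P" by (auto simp: gr_hom_def)
  \<comment> \<open>The identity of \<open>P\<close> is lifted along \<open>?g\<close>. The module
    \<open>?F\<close> lives on a function type different from that of the test modules, hence the
    appeal to \<open>gr_projective_lifting\<close>.\<close>
  have "\<exists>h\<in>gr_hom \<Gamma> R P ?F. \<forall>x\<in>carrier P. ?g (h x) = x"
    using gr_projective_lifting[OF P proj F P, unfolded gr_lifting_def, rule_format, OF g id surj] .
  then obtain h where h: "h \<in> gr_hom \<Gamma> R P ?F" "\<And>x. x \<in> carrier P \<Longrightarrow> ?g (h x) = x"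
    by blast
  show thesis
  proof (rule that[of "\<lambda>i x. h x i"])
    fix \<sigma> p assume "\<sigma> \<in> carrier \<Gamma>" "p \<in> homog P \<sigma>"
    then have "(\<lambda>u. u (\<sigma>, p)) \<in> gr_hom \<Gamma> R ?F (M (\<sigma>, p))"
      by (intro gr_direct_sum_coordinate[OF R M]) (auto simp: J_def)
    note c = gr_homD[OF this]
    show "(\<lambda>x. h x (\<sigma>, p)) \<in> gr_hom \<Gamma> R P (P.shifted \<sigma>)"
      using c(2-5) gr_homD(2-5)[OF h(1)] by (auto simp: gr_hom_def M_def simp del: P.shifted_simps)
  next
    fix x assume x: "x \<in> carrier P"
    \<comment> \<open>The finite set of indices is the support of \<open>h x\<close>, so the dual
      basis expansion is the equation \<open>?g (h x) = x\<close> written out.\<close>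
    let ?S = "{i \<in> J. h x i \<noteq> \<zero>\<^bsub>M i\<^esub>}"
    have "finite ?S" using gr_homD(2)[OF h(1) x] by (simp add: gr_direct_sum_simps)
    moreover have "x = finsum P (\<lambda>i. ract P (snd i) (h x i)) ?S"
      using h(2)[OF x] by (simp add: cotuple_def \<psi>_def)
    ultimately show "\<exists>S. finite S \<and> S \<subseteq> Sigma (carrier \<Gamma>) (homog P) \<and>
        x = finsum P (\<lambda>i. ract P (snd i) (h x i)) S"
      unfolding J_def by blast
  qed
qed

section \<open>Existence of a gr-maximal submodule and properness of the graded radical\<close>

theorem proposition7p8:
  fixes \<Gamma> :: "'g arrows" and R :: "('r, 'g) graded" and P :: "('p, 'g, 'r) graded_rmod"
  assumes "groupoid \<Gamma>"
    and "graded_ring \<Gamma> R"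
    and "graded_right_module \<Gamma> R P"
    and "gr_projective \<Gamma> R P"
    and "carrier P \<noteq> {\<zero>\<^bsub>P\<^esub>}"
  shows "gr_rad \<Gamma> R P \<noteq> carrier P \<and> (\<exists>N. gr_maximal \<Gamma> R P N)"
proof -
  interpret P: graded_right_module \<Gamma> R P by fact
  have ex: "\<exists>N. gr_maximal \<Gamma> R P N"
  proof (rule ccontr)
    assume no_max: "\<nexists>N. gr_maximal \<Gamma> R P N"
    obtain f where f: "\<And>\<sigma> p. \<sigma> \<in> carrier \<Gamma> \<Longrightarrow> p \<in> homog P \<sigma> \<Longrightarrow> f (\<sigma>, p) \<in> gr_hom \<Gamma> R P (P.shifted \<sigma>)"
      and f_sum: "\<And>x. x \<in> carrier P \<Longrightarrow> \<exists>S. finite S \<and> S \<subseteq> Sigma (carrier \<Gamma>) (homog P) \<and>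
        x = finsum P (\<lambda>i. ract P (snd i) (f i x)) S"
      by (rule dual_basis[OF assms(3,4)], rule that)
    have "x = \<zero>\<^bsub>P\<^esub>" if x: "x \<in> carrier P" for x
    proof -
      obtain S where S: "finite S" "S \<subseteq> Sigma (carrier \<Gamma>) (homog P)"
        "x = finsum P (\<lambda>i. ract P (snd i) (f i x)) S"
        using f_sum[OF x] by blast
      show ?thesis
      proof (rule P.dual_basis_elimination[where \<sigma> = fst and p = snd and f = f, OF no_max x S(1) _ _ _ S(3)])
        fix i assume "i \<in> S"
        with S(2) obtain \<sigma> p where "i = (\<sigma>, p)" "\<sigma> \<in> carrier \<Gamma>" "p \<in> homog P \<sigma>" by blast
        then show "fst i \<in> carrier \<Gamma>" "snd i \<in> homog P (fst i)"
          "f i \<in> gr_hom \<Gamma> R P (P.shifted (fst i))"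
          using f by simp_all
      qed
    qed
    then have "carrier P = {\<zero>\<^bsub>P\<^esub>}" by auto
    with assms(5) show False ..
  qed
  then obtain N where N: "gr_maximal \<Gamma> R P N" by blast
  \<comment> \<open>As a gr-maximal submodule exists, the radical is the intersection of all of them
    and lies in the proper submodule \<open>N\<close>.\<close>
  then have "gr_rad \<Gamma> R P \<subseteq> N" by (auto simp: gr_rad_def)
  moreover have "N \<subset> carrier P"
    using N additive_subgroup.a_subset[of N P] by (auto simp: gr_maximal_def gr_submodule_def)
  ultimately show ?thesis using ex by blast
qed

end
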